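(* Let $K$ be a field of characteristic $p>0$ and consider the field extension $K(T)/K(T^p)$, where $K(T)$ is the field of rational functions in one variable. The ring maps determined by $$\mathrm{Q}_{K(T)/K(T^p)}\longrightarrow K(T)\otimes_K\Lambda_K[S],\quad T\otimes1\otimes1\mapsto T+S,\quad 1\otimes T\otimes 1\mapsto T-S,\quad 1\otimes1\otimes T\mapsto T,$$ $$K(T)\otimes_K\Lambda_K[S]\longrightarrow\mathrm{Q}_{K(T)/K(T^p)},\quad T\mapsto1\otimes1\otimes T,\quad S\mapsto T\otimes1\otimes1-1\otimes1\otimes T$$ are inverse isomorphisms, so in particular $\mathrm{W}_{K(T)/K(T^p)}\cong K(T)$. Consequently, the $K(T)$-vector space $$\ker\left(\mathrm{Quad}_{K(T)/K(T^p)}(K(T)^2,K(T))\to\mathrm{Quad}_{K(T)}(K(T),K(T))^2\right)$$ of $K(T)/K(T^p)$-quadratic forms on $K(T)^2$ that vanish on both $K(T)\oplus0$ and $0\oplus K(T)$ (the map being given by restriction to the two summands) is isomorphic to $$\mathrm{Hom}_{K(T)}(K(T)\otimes_K\Lambda_K[S],K(T))=\mathrm{Hom}_K(\Lambda_K[S],K(T))=K(T)^2,$$ with $f\colon K(T)\otimes_K\Lambda_K[S]\to K(T)$ corresponding to the form $$(F,G)\longmapsto f(F(T+S)G(T-S))=FG\,f(1)+(F'G-FG')f(S),$$ and similarly $$\mathrm{Quad}_{K(T)/K(T^p)}(K(T)^2,K(T))\cong\mathrm{Quad}_{K(T)}(K(T)^2,K(T))\oplus K(T).$$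
   Context: For a map $q$ between abelian groups, $\mathrm{pol}_q(x,y)=q(x+y)-q(x)-q(y)$. For a homomorphism $\varphi\colon R\to A$ of commutative rings and $A$-modules $M,N$, $\mathrm{Quad}_\varphi(M,N)=\mathrm{Quad}_{A/R}(M,N)$ denotes the $A$-module (under pointwise operations) of maps $q\colon M\to N$ with $q(am)=a^2q(m)$ for all $a\in A$, $m\in M$, and with $\mathrm{pol}_q$ being $R$-bilinear (such $q$ are called $A/R$-quadratic); $\mathrm{Quad}_A=\mathrm{Quad}_{\mathrm{id}_A}$. Let $\Delta_\varphi\subseteq A\otimes_R A$ be the $R$-subalgebra spanned by the elements $a\otimes a$; regard $A$ as a $\Delta_\varphi$-algebra via multiplication. Put $\mathrm{Q}_\varphi=\mathrm{Q}_{A/R}=(A\otimes_R A)\otimes_{\Delta_\varphi}A$, an $A$-algebra via $a\mapsto1\otimes1\otimes a$, augmented over $A$ by multiplication, and let $\mathrm{W}_\varphi=\mathrm{W}_{A/R}$ be the kernel of the augmentation $\mathrm{Q}_\varphi\to A$. $\Lambda_K[S]=K[S]/(S^2)$. For a rational function $F\in K(T)$, $F(T\pm S)\in K(T)\otimes_K\Lambda_K[S]$ denotes the result of substituting $T\pm S$ for $T$, i.e. the image of $F$ under the $K$-algebra map $K(T)\to K(T)\otimes_K\Lambda_K[S]$ with $T\mapsto T\pm S$, and $F'$ is the derivative of $F$ with respect to $T$. *)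

theory Defs
  imports
    "HOL-Algebra.Algebraic_Closure_Type"
    "HOL-Algebra.Generated_Fields"
    "HOL-Algebra.Free_Abelian_Groups"
    "HOL-Computational_Algebra.Polynomial_Factorial"
begin

section \<open>Tensor products of commutative algebras\<close>

text \<open>The monoid ring \<open>\<int>[G]\<close>: the free abelian group on \<open>carrier G\<close> with the
  multiplication extending that of \<open>G\<close> bilinearly.\<close>

definition int_monoid_ring :: "('a, 'm) monoid_scheme \<Rightarrow> ('a \<Rightarrow>\<^sub>0 int) ring" where
  "int_monoid_ring G =
     \<lparr>carrier = carrier (free_Abelian_group (carrier G)),
      monoid.mult = (\<lambda>x y. frag_extend (\<lambda>s. frag_extend (\<lambda>t. frag_of (s \<otimes>\<^bsub>G\<^esub> t)) y) x),
      one = frag_of \<one>\<^bsub>G\<^esub>,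
      ring.zero = 0,
      add = (+)\<rparr>"

text \<open>For ring maps \<open>f: B \<rightarrow> C\<close> and \<open>g: B \<rightarrow> D\<close> the tensor product of \<open>C\<close> and \<open>D\<close> over \<open>B\<close>
  is the free abelian group on \<open>C \<times> D\<close> modulo the \<open>B\<close>-bilinearity relations. The subgroup
  generated by these relations is stable under multiplication by \<open>(c, d)\<close>, hence is the ideal
  they generate in \<open>\<int>[C \<times> D]\<close>.\<close>

definition tensor_ideal ::
  "('b, 'x) ring_scheme \<Rightarrow> ('c, 'y) ring_scheme \<Rightarrow> ('d, 'z) ring_scheme \<Rightarrow>
   ('b \<Rightarrow> 'c) \<Rightarrow> ('b \<Rightarrow> 'd) \<Rightarrow> ('c \<times> 'd \<Rightarrow>\<^sub>0 int) set" where
  "tensor_ideal B C D f g = Idl\<^bsub>int_monoid_ring (C \<times>\<times> D)\<^esub>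
     ({frag_of (c \<oplus>\<^bsub>C\<^esub> c', d) - frag_of (c, d) - frag_of (c', d) | c c' d.
         c \<in> carrier C \<and> c' \<in> carrier C \<and> d \<in> carrier D}
    \<union> {frag_of (c, d \<oplus>\<^bsub>D\<^esub> d') - frag_of (c, d) - frag_of (c, d') | c d d'.
         c \<in> carrier C \<and> d \<in> carrier D \<and> d' \<in> carrier D}
    \<union> {frag_of (c \<otimes>\<^bsub>C\<^esub> f b, d) - frag_of (c, g b \<otimes>\<^bsub>D\<^esub> d) | b c d.
         b \<in> carrier B \<and> c \<in> carrier C \<and> d \<in> carrier D})"

type_synonym ('c, 'd) tensor = "('c \<times> 'd \<Rightarrow>\<^sub>0 int) set"

definition tensor_alg ::
  "('b, 'x) ring_scheme \<Rightarrow> ('c, 'y) ring_scheme \<Rightarrow> ('d, 'z) ring_scheme \<Rightarrow>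
   ('b \<Rightarrow> 'c) \<Rightarrow> ('b \<Rightarrow> 'd) \<Rightarrow> ('c, 'd) tensor ring" where
  "tensor_alg B C D f g = int_monoid_ring (C \<times>\<times> D) Quot tensor_ideal B C D f g"

definition pure_tensor ::
  "('b, 'x) ring_scheme \<Rightarrow> ('c, 'y) ring_scheme \<Rightarrow> ('d, 'z) ring_scheme \<Rightarrow>
   ('b \<Rightarrow> 'c) \<Rightarrow> ('b \<Rightarrow> 'd) \<Rightarrow> 'c \<Rightarrow> 'd \<Rightarrow> ('c, 'd) tensor" where
  "pure_tensor B C D f g c d =
     tensor_ideal B C D f g +>\<^bsub>int_monoid_ring (C \<times>\<times> D)\<^esub> frag_of (c, d)"

text \<open>The ring map out of the tensor product induced by \<open>u: C \<rightarrow> E\<close> and \<open>v: D \<rightarrow> E\<close>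
  (which have to agree on \<open>B\<close>).\<close>

definition tensor_copair ::
  "('b, 'x) ring_scheme \<Rightarrow> ('c, 'y) ring_scheme \<Rightarrow> ('d, 'z) ring_scheme \<Rightarrow>
   ('b \<Rightarrow> 'c) \<Rightarrow> ('b \<Rightarrow> 'd) \<Rightarrow> ('e, 'w) ring_scheme \<Rightarrow> ('c \<Rightarrow> 'e) \<Rightarrow> ('d \<Rightarrow> 'e) \<Rightarrow>
   ('c, 'd) tensor \<Rightarrow> 'e" where
  "tensor_copair B C D f g E u v =
     (THE h. h \<in> ring_hom (tensor_alg B C D f g) E \<inter> extensional (carrier (tensor_alg B C D f g))
       \<and> (\<forall>c\<in>carrier C. h (pure_tensor B C D f g c \<one>\<^bsub>D\<^esub>) = u c)
       \<and> (\<forall>d\<in>carrier D. h (pure_tensor B C D f g \<one>\<^bsub>C\<^esub> d) = v d))"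

text \<open>A \<open>K\<close>-algebra is given by its structure map; \<open>alg_hom K i B j C\<close> is the set of
  \<open>K\<close>-algebra maps from \<open>(B, i: K \<rightarrow> B)\<close> to \<open>(C, j: K \<rightarrow> C)\<close>.\<close>

definition alg_hom ::
  "('k, 'x) ring_scheme \<Rightarrow> ('k \<Rightarrow> 'b) \<Rightarrow> ('b, 'y) ring_scheme \<Rightarrow>
   ('k \<Rightarrow> 'c) \<Rightarrow> ('c, 'z) ring_scheme \<Rightarrow> ('b \<Rightarrow> 'c) set" where
  "alg_hom K i B j C = {h \<in> ring_hom B C. \<forall>k\<in>carrier K. h (i k) = j k}"


section \<open>Modules\<close>

text \<open>Module records extend ring records; the multiplicative fields of a module record carry no
  meaning and are left unspecified below.\<close>

definition alg_module :: "('b, 'y) ring_scheme \<Rightarrow> ('a \<Rightarrow> 'b) \<Rightarrow> ('a, 'b) module" where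
  "alg_module B i =
     \<lparr>carrier = carrier B, monoid.mult = monoid.mult B, one = \<one>\<^bsub>B\<^esub>, ring.zero = \<zero>\<^bsub>B\<^esub>, add = add B,
      module.smult = (\<lambda>a x. i a \<otimes>\<^bsub>B\<^esub> x)\<rparr>"

definition restrict_scalars ::
  "('r \<Rightarrow> 'a) \<Rightarrow> ('a, 'm, 'y) module_scheme \<Rightarrow> ('r, 'm) module" where
  "restrict_scalars \<phi> M =
     \<lparr>carrier = carrier M, monoid.mult = monoid.mult M, one = \<one>\<^bsub>M\<^esub>, ring.zero = \<zero>\<^bsub>M\<^esub>, add = add M,
      module.smult = (\<lambda>r x. \<phi> r \<odot>\<^bsub>M\<^esub> x)\<rparr>"

definition module_dsum ::
  "('a, 'm, 'y) module_scheme \<Rightarrow> ('a, 'n, 'z) module_scheme \<Rightarrow> ('a, 'm \<times> 'n) module" where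
  "module_dsum M N =
     \<lparr>carrier = carrier M \<times> carrier N, monoid.mult = undefined, one = undefined,
      ring.zero = (\<zero>\<^bsub>M\<^esub>, \<zero>\<^bsub>N\<^esub>),
      add = (\<lambda>(x, y) (x', y'). (x \<oplus>\<^bsub>M\<^esub> x', y \<oplus>\<^bsub>N\<^esub> y')),
      module.smult = (\<lambda>a (x, y). (a \<odot>\<^bsub>M\<^esub> x, a \<odot>\<^bsub>N\<^esub> y))\<rparr>"

text \<open>A module of functions \<open>U \<rightarrow> N\<close> under pointwise operations, with carrier \<open>C\<close>. Functions are
  kept extensional on \<open>U\<close> so that equality is equality of maps on \<open>U\<close>.\<close>

definition pointwise_module ::
  "'m set \<Rightarrow> ('a, 'n, 'z) module_scheme \<Rightarrow> ('m \<Rightarrow> 'n) set \<Rightarrow> ('a, 'm \<Rightarrow> 'n) module" where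
  "pointwise_module U N C =
     \<lparr>carrier = C, monoid.mult = undefined, one = undefined,
      ring.zero = (\<lambda>x\<in>U. \<zero>\<^bsub>N\<^esub>),
      add = (\<lambda>f g. \<lambda>x\<in>U. f x \<oplus>\<^bsub>N\<^esub> g x),
      module.smult = (\<lambda>a f. \<lambda>x\<in>U. a \<odot>\<^bsub>N\<^esub> f x)\<rparr>"

definition mod_hom ::
  "('a, 'x) ring_scheme \<Rightarrow> ('a, 'm, 'y) module_scheme \<Rightarrow> ('a, 'n, 'z) module_scheme \<Rightarrow>
   ('m \<Rightarrow> 'n) set" where
  "mod_hom A M N =
     {h \<in> carrier M \<rightarrow> carrier N.
        (\<forall>x\<in>carrier M. \<forall>y\<in>carrier M. h (x \<oplus>\<^bsub>M\<^esub> y) = h x \<oplus>\<^bsub>N\<^esub> h y) \<and>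
        (\<forall>a\<in>carrier A. \<forall>x\<in>carrier M. h (a \<odot>\<^bsub>M\<^esub> x) = a \<odot>\<^bsub>N\<^esub> h x)}"

definition mod_iso ::
  "('a, 'x) ring_scheme \<Rightarrow> ('a, 'm, 'y) module_scheme \<Rightarrow> ('a, 'n, 'z) module_scheme \<Rightarrow>
   ('m \<Rightarrow> 'n) set" where
  "mod_iso A M N = {h \<in> mod_hom A M N. bij_betw h (carrier M) (carrier N)}"

definition mod_ker ::
  "('a, 'm) module \<Rightarrow> ('a, 'n, 'z) module_scheme \<Rightarrow> ('m \<Rightarrow> 'n) \<Rightarrow> ('a, 'm) module" where
  "mod_ker M N h = M\<lparr>carrier := {x \<in> carrier M. h x = \<zero>\<^bsub>N\<^esub>}\<rparr>"

text \<open>\<open>Hom\<^sub>R(M, N)\<close> for an \<open>R\<close>-module \<open>M\<close>, a ring map \<open>\<phi>: R \<rightarrow> A\<close> and an \<open>A\<close>-module \<open>N\<close>; it is an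
  \<open>A\<close>-module through \<open>N\<close>.\<close>

definition hom_module ::
  "('r, 'x) ring_scheme \<Rightarrow> ('r \<Rightarrow> 'a) \<Rightarrow> ('r, 'm, 'y) module_scheme \<Rightarrow>
   ('a, 'n, 'z) module_scheme \<Rightarrow> ('a, 'm \<Rightarrow> 'n) module" where
  "hom_module R \<phi> M N = pointwise_module (carrier M) N
     (mod_hom R M (restrict_scalars \<phi> N) \<inter> extensional (carrier M))"


section \<open>Quadratic maps relative to a ring homomorphism\<close>

definition polar ::
  "('a, 'm, 'y) module_scheme \<Rightarrow> ('a, 'n, 'z) module_scheme \<Rightarrow> ('m \<Rightarrow> 'n) \<Rightarrow> 'm \<Rightarrow> 'm \<Rightarrow> 'n" where
  "polar M N q x y = q (x \<oplus>\<^bsub>M\<^esub> y) \<ominus>\<^bsub>N\<^esub> q x \<ominus>\<^bsub>N\<^esub> q y"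

definition bilinear_maps ::
  "('r, 'x) ring_scheme \<Rightarrow> ('r, 'm, 'y) module_scheme \<Rightarrow> ('r, 'n, 'z) module_scheme \<Rightarrow>
   ('m \<Rightarrow> 'm \<Rightarrow> 'n) set" where
  "bilinear_maps R M N =
     {b. \<forall>x\<in>carrier M. b x \<in> mod_hom R M N \<and> (\<lambda>y. b y x) \<in> mod_hom R M N}"

definition quad_module ::
  "('r, 'x) ring_scheme \<Rightarrow> ('r \<Rightarrow> 'a) \<Rightarrow> ('a, 'y) ring_scheme \<Rightarrow>
   ('a, 'm, 'z) module_scheme \<Rightarrow> ('a, 'n, 'w) module_scheme \<Rightarrow> ('a, 'm \<Rightarrow> 'n) module" where
  "quad_module R \<phi> A M N = pointwise_module (carrier M) N
     {q \<in> carrier M \<rightarrow>\<^sub>E carrier N.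
        (\<forall>a\<in>carrier A. \<forall>m\<in>carrier M. q (a \<odot>\<^bsub>M\<^esub> m) = (a [^]\<^bsub>A\<^esub> (2::nat)) \<odot>\<^bsub>N\<^esub> q m) \<and>
        polar M N q \<in> bilinear_maps R (restrict_scalars \<phi> M) (restrict_scalars \<phi> N)}"


section \<open>The algebra \<open>Q\<close> and the module \<open>W\<close> of a ring homomorphism\<close>

context
  fixes R :: "('r, 'x) ring_scheme" and \<phi> :: "'r \<Rightarrow> 'a" and A :: "('a, 'y) ring_scheme"
begin

definition tensor_square :: "('a, 'a) tensor ring" where
  "tensor_square = tensor_alg R A A \<phi> \<phi>"

definition square_tensor :: "'a \<Rightarrow> 'a \<Rightarrow> ('a, 'a) tensor" where
  "square_tensor = pure_tensor R A A \<phi> \<phi>"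

text \<open>The \<open>R\<close>-subalgebra \<open>\<Delta>\<close>, as a ring with the structure inherited from the tensor square; an
  \<open>R\<close>-subalgebra is a subring containing the image of \<open>R\<close>.\<close>

definition diag_alg :: "('a, 'a) tensor ring" where
  "diag_alg = tensor_square\<lparr>carrier := generate_ring tensor_square
     ({square_tensor (\<phi> r) \<one>\<^bsub>A\<^esub> | r. r \<in> carrier R} \<union> {square_tensor a a | a. a \<in> carrier A})\<rparr>"

definition mult_map :: "('a, 'a) tensor \<Rightarrow> 'a" where
  "mult_map = tensor_copair R A A \<phi> \<phi> A (\<lambda>a. a) (\<lambda>a. a)"

definition Q_alg :: "(('a, 'a) tensor, 'a) tensor ring" where
  "Q_alg = tensor_alg diag_alg tensor_square A (\<lambda>x. x) mult_map"

definition Q_tensor :: "'a \<Rightarrow> 'a \<Rightarrow> 'a \<Rightarrow> (('a, 'a) tensor, 'a) tensor" where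
  "Q_tensor a b c = pure_tensor diag_alg tensor_square A (\<lambda>x. x) mult_map (square_tensor a b) c"

definition Q_struct :: "'a \<Rightarrow> (('a, 'a) tensor, 'a) tensor" where
  "Q_struct a = Q_tensor \<one>\<^bsub>A\<^esub> \<one>\<^bsub>A\<^esub> a"

definition Q_aug :: "(('a, 'a) tensor, 'a) tensor \<Rightarrow> 'a" where
  "Q_aug = tensor_copair diag_alg tensor_square A (\<lambda>x. x) mult_map A mult_map (\<lambda>a. a)"

definition W_module :: "('a, (('a, 'a) tensor, 'a) tensor) module" where
  "W_module = (alg_module Q_alg Q_struct)\<lparr>carrier := a_kernel Q_alg A Q_aug\<rparr>"

end


section \<open>Rational functions and dual numbers\<close>

type_synonym 'k ratfun = "'k poly fract"

abbreviation const_field :: "'k::field ring" where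
  "const_field \<equiv> ring_of_type_algebra"

abbreviation ratfun_field :: "'k::field ratfun ring" where
  "ratfun_field \<equiv> ring_of_type_algebra"

abbreviation ratfun_module :: "('k::field ratfun, 'k ratfun) module" where
  "ratfun_module \<equiv> alg_module ratfun_field (\<lambda>a. a)"

definition rat_const :: "'k::field \<Rightarrow> 'k ratfun" where
  "rat_const k = to_fract [:k:]"

definition rat_T :: "'k::field ratfun" where
  "rat_T = to_fract [:0, 1:]"

definition frob_subfield :: "nat \<Rightarrow> 'k::field ratfun ring" where
  "frob_subfield p = ratfun_field\<lparr>carrier :=
     generate_field ratfun_field (range rat_const \<union> {rat_T ^ p})\<rparr>"

text \<open>The formal derivative with respect to \<open>T\<close>, by the quotient rule; it does not depend on the
  representation of the fraction.\<close>

definition rat_deriv :: "'k::field ratfun \<Rightarrow> 'k ratfun" where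
  "rat_deriv F = (THE D. \<exists>a b. b \<noteq> 0 \<and> F = Fract a b \<and>
     D = Fract (pderiv a * b - a * pderiv b) (b * b))"

lemma rat_deriv_Fract:
  fixes a b :: "'k::field poly"
  assumes "b \<noteq> 0"
  shows "rat_deriv (Fract a b) = Fract (pderiv a * b - a * pderiv b) (b * b)"
  unfolding rat_deriv_def
proof (rule the_equality)
  show "\<exists>a' b'. b' \<noteq> 0 \<and> Fract a b = Fract a' b' \<and>
      Fract (pderiv a * b - a * pderiv b) (b * b) = Fract (pderiv a' * b' - a' * pderiv b') (b' * b')"
    using assms by blast
next
  fix D
  assume "\<exists>c d. d \<noteq> 0 \<and> Fract a b = Fract c d \<and> D = Fract (pderiv c * d - c * pderiv d) (d * d)"
  then obtain c d where d: "d \<noteq> 0" and e: "a * d = c * b"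
    and D: "D = Fract (pderiv c * d - c * pderiv d) (d * d)"
    using assms by (auto simp: eq_fract)
  from e have "pderiv (a * d) = pderiv (c * b)" by simp
  then have e': "a * pderiv d + d * pderiv a = c * pderiv b + b * pderiv c"
    by (simp add: pderiv_mult)
  have "(pderiv a * b - a * pderiv b) * (d * d) =
      b * d * (a * pderiv d + d * pderiv a) - (a * d) * (b * pderiv d) - (a * d) * (pderiv b * d)"
    by (simp add: algebra_simps)
  also have "\<dots> = (pderiv c * d - c * pderiv d) * (b * b)"
    unfolding e e' by (simp add: algebra_simps)
  finally have "(pderiv c * d - c * pderiv d) * (b * b) = (pderiv a * b - a * pderiv b) * (d * d)" ..
  then show "D = Fract (pderiv a * b - a * pderiv b) (b * b)"
    unfolding D using assms d by (simp add: eq_fract)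
qed

definition dual_ideal :: "'k::field poly set" where
  "dual_ideal = PIdl\<^bsub>ring_of_type_algebra\<^esub> ([:0, 1:] ^ 2)"

definition dual_alg :: "'k::field poly set ring" where
  "dual_alg = ring_of_type_algebra Quot dual_ideal"

definition dual_const :: "'k::field \<Rightarrow> 'k poly set" where
  "dual_const k = dual_ideal +>\<^bsub>ring_of_type_algebra\<^esub> [:k:]"

definition dual_S :: "'k::field poly set" where
  "dual_S = dual_ideal +>\<^bsub>ring_of_type_algebra\<^esub> [:0, 1:]"

abbreviation dual_module :: "('k::field, 'k poly set) module" where
  "dual_module \<equiv> alg_module dual_alg dual_const"

text \<open>The base is \<open>K\<close>; \<open>rat_dual\<close> is regarded as a \<open>K(T)\<close>-algebra through the left factor.\<close>

definition rat_dual :: "('k::field ratfun, 'k poly set) tensor ring" where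
  "rat_dual = tensor_alg const_field ratfun_field dual_alg rat_const dual_const"

definition rd_tensor :: "'k::field ratfun \<Rightarrow> 'k poly set \<Rightarrow> ('k ratfun, 'k poly set) tensor" where
  "rd_tensor = pure_tensor const_field ratfun_field dual_alg rat_const dual_const"

definition rd_struct :: "'k::field ratfun \<Rightarrow> ('k ratfun, 'k poly set) tensor" where
  "rd_struct F = rd_tensor F \<one>\<^bsub>dual_alg\<^esub>"

definition rd_const :: "'k::field \<Rightarrow> ('k ratfun, 'k poly set) tensor" where
  "rd_const k = rd_struct (rat_const k)"

definition rd_T :: "('k::field ratfun, 'k poly set) tensor" where
  "rd_T = rd_struct rat_T"

definition rd_S :: "('k::field ratfun, 'k poly set) tensor" where
  "rd_S = rd_tensor 1 dual_S"

abbreviation rat_dual_module ::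
  "('k::field ratfun, ('k ratfun, 'k poly set) tensor) module" where
  "rat_dual_module \<equiv> alg_module rat_dual rd_struct"

text \<open>\<open>rat_subst u F\<close> is the image of \<open>F\<close> under the \<open>K\<close>-algebra map
  \<open>K(T) \<rightarrow> K(T) \<otimes>\<^sub>K \<Lambda>\<^sub>K[S]\<close> with \<open>T \<mapsto> u\<close>.\<close>

definition rat_subst ::
  "('k::field ratfun, 'k poly set) tensor \<Rightarrow> 'k ratfun \<Rightarrow> ('k ratfun, 'k poly set) tensor" where
  "rat_subst u = (THE h. h \<in> alg_hom const_field rat_const ratfun_field rd_const rat_dual
     \<and> h rat_T = u)"

abbreviation QT_alg ::
  "nat \<Rightarrow> (('k::field ratfun, 'k ratfun) tensor, 'k ratfun) tensor ring" where
  "QT_alg p \<equiv> Q_alg (frob_subfield p) (\<lambda>x. x) ratfun_field"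

abbreviation QT_tensor ::
  "nat \<Rightarrow> 'k::field ratfun \<Rightarrow> 'k ratfun \<Rightarrow> 'k ratfun \<Rightarrow>
   (('k ratfun, 'k ratfun) tensor, 'k ratfun) tensor" where
  "QT_tensor p \<equiv> Q_tensor (frob_subfield p) (\<lambda>x. x) ratfun_field"

abbreviation QT_const ::
  "nat \<Rightarrow> 'k::field \<Rightarrow> (('k ratfun, 'k ratfun) tensor, 'k ratfun) tensor" where
  "QT_const p \<equiv> (\<lambda>k. Q_struct (frob_subfield p) (\<lambda>x. x) ratfun_field (rat_const k))"

abbreviation WT_module ::
  "nat \<Rightarrow> ('k::field ratfun, (('k ratfun, 'k ratfun) tensor, 'k ratfun) tensor) module" where
  "WT_module p \<equiv> W_module (frob_subfield p) (\<lambda>x. x) ratfun_field"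

abbreviation quad_rel ::
  "nat \<Rightarrow> ('k::field ratfun, 'm) module \<Rightarrow> ('k ratfun, 'n) module \<Rightarrow>
   ('k ratfun, 'm \<Rightarrow> 'n) module" where
  "quad_rel p \<equiv> quad_module (frob_subfield p) (\<lambda>x. x) ratfun_field"

abbreviation quad_abs ::
  "('k::field ratfun, 'm) module \<Rightarrow> ('k ratfun, 'n) module \<Rightarrow> ('k ratfun, 'm \<Rightarrow> 'n) module" where
  "quad_abs \<equiv> quad_module ratfun_field (\<lambda>x. x) ratfun_field"

definition restrict_summands ::
  "('k::field ratfun \<times> 'k ratfun \<Rightarrow> 'k ratfun) \<Rightarrow>
   ('k ratfun \<Rightarrow> 'k ratfun) \<times> ('k ratfun \<Rightarrow> 'k ratfun)" where
  "restrict_summands q = ((\<lambda>F. q (F, 0)), (\<lambda>G. q (0, G)))"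

end

theory Submission
  imports Defs
begin

text \<open>In \<open>Q\<close> the elements \<open>x = T \<otimes> 1 \<otimes> 1\<close> and \<open>y = 1 \<otimes> T \<otimes> 1\<close> satisfy \<open>xy = t\<^sup>2\<close> and \<open>x + y = 2t\<close>, where
  \<open>t = 1 \<otimes> 1 \<otimes> T\<close>, so \<open>x - t\<close> squares to zero and \<open>S \<mapsto> x - t\<close> defines a map from the dual
  numbers over \<open>K(T)\<close> to \<open>Q\<close>. A ring map out of \<open>K(T)\<close> is determined on constants and on \<open>T\<close>,
  so \<open>F \<otimes> 1 \<otimes> 1\<close> and \<open>1 \<otimes> F \<otimes> 1\<close> are the images of \<open>F(T + S) = F + F'S\<close> and \<open>F(T - S) = F - F'S\<close>;
  hence the map is onto. The maps \<open>F \<mapsto> F(T \<plusminus> S)\<close> agree on \<open>K(T\<^sup>p)\<close>, where derivatives vanish, and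
  multiply to \<open>F\<^sup>2\<close>, so by the universal property they give a left inverse.

  A relative quadratic form on the plane is \<open>a F\<^sup>2 + b(F, G) + c G\<^sup>2\<close> with \<open>b\<close> bilinear over \<open>K(T\<^sup>p)\<close> and
  \<open>b(tF, tG) = t\<^sup>2 b(F, G)\<close>. Such a \<open>b\<close> is determined by \<open>b(1, 1)\<close> and \<open>b(T, 1)\<close>, and the forms
  \<open>FG\<close> and \<open>F'G - FG'\<close> realise all values.\<close>

section \<open>Monoid rings over the integers\<close>

text \<open>The obstacle is that the tensor products are quotients of monoid rings, where it is hard
  to see that elements differ. They are therefore used only through generation by pure tensors and
  the universal property, and the dual numbers are also given as a type \<open>dual\<close>. Each
  ring is shown to be a copy of that type: spanning is a calculation with generators, while the
  independence of 1 and S is certified by a ring map back to \<open>dual\<close>.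

  Nothing is divided by 2, so characteristic 2 is not a special case: the square-zero element is x -
  t, not half of x - y, and the coefficients of the squares in a form are read off its values, not
  its polar form.

  The recurrence for b(T^n, 1) has characteristic polynomial (X - T)^2. Its double root gives the
  two solutions T^n and n T^(n-1), hence the product FG and a form with derivatives. In Q the same
  double root appears as (x - t)^2 = 0. Positivity of p matters where fractions are reduced to
  polynomials, since there the p-th power of a denominator has to act as a scalar.\<close>

lemma int_monoid_ring_simps [simp]:
  "x \<in> carrier (int_monoid_ring G) \<longleftrightarrow> Poly_Mapping.keys x \<subseteq> carrier G"
  "\<zero>\<^bsub>int_monoid_ring G\<^esub> = 0"
  "\<one>\<^bsub>int_monoid_ring G\<^esub> = frag_of \<one>\<^bsub>G\<^esub>"
  "x \<oplus>\<^bsub>int_monoid_ring G\<^esub> y = x + y"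
  by (simp_all add: int_monoid_ring_def)

lemma int_monoid_ring_mult:
  "x \<otimes>\<^bsub>int_monoid_ring G\<^esub> y = frag_extend (\<lambda>s. frag_extend (\<lambda>t. frag_of (s \<otimes>\<^bsub>G\<^esub> t)) y) x"
  by (simp add: int_monoid_ring_def)

lemma int_monoid_ring_mult_of [simp]:
  "frag_of s \<otimes>\<^bsub>int_monoid_ring G\<^esub> frag_of t = frag_of (s \<otimes>\<^bsub>G\<^esub> t)"
  by (simp add: int_monoid_ring_mult)

lemma int_monoid_ring_mult_0 [simp]:
  "0 \<otimes>\<^bsub>int_monoid_ring G\<^esub> y = 0" "x \<otimes>\<^bsub>int_monoid_ring G\<^esub> 0 = 0"
  by (auto simp: int_monoid_ring_mult intro: frag_extend_eq_0)

lemma frag_extend_diff_fun: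
  "frag_extend (\<lambda>s. f s - g s) x = frag_extend f x - frag_extend g x"
  using subset_UNIV[of "Poly_Mapping.keys x"]
  by (induction x rule: frag_induction) (auto simp: frag_extend_diff)

lemma int_monoid_ring_mult_diff:
  "(x - x') \<otimes>\<^bsub>int_monoid_ring G\<^esub> y = x \<otimes>\<^bsub>int_monoid_ring G\<^esub> y - x' \<otimes>\<^bsub>int_monoid_ring G\<^esub> y"
  "x \<otimes>\<^bsub>int_monoid_ring G\<^esub> (y - y') = x \<otimes>\<^bsub>int_monoid_ring G\<^esub> y - x \<otimes>\<^bsub>int_monoid_ring G\<^esub> y'"
  by (simp_all add: int_monoid_ring_mult frag_extend_diff frag_extend_diff_fun)

lemma int_monoid_ring_l_distr:
  "(x + x') \<otimes>\<^bsub>int_monoid_ring G\<^esub> y = x \<otimes>\<^bsub>int_monoid_ring G\<^esub> y + x' \<otimes>\<^bsub>int_monoid_ring G\<^esub> y"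
  by (simp add: int_monoid_ring_mult frag_extend_add)

text \<open>Every law is additive in each variable, so \<open>frag_induction\<close> reduces it to
  basis elements, where it is a law of \<open>G\<close>. That rule builds elements by differences,
  which is why \<open>int_monoid_ring_mult_diff\<close> does the work.\<close>

lemma cring_int_monoid_ring:
  assumes "comm_monoid G"
  shows "cring (int_monoid_ring G)"
proof -
  interpret G: comm_monoid G by fact
  let ?M = "int_monoid_ring G"
  have closed: "x \<otimes>\<^bsub>?M\<^esub> y \<in> carrier ?M" if x: "x \<in> carrier ?M" and y: "y \<in> carrier ?M" for x y
  proof -
    from x have "Poly_Mapping.keys x \<subseteq> carrier G" by simp
    then have "Poly_Mapping.keys (x \<otimes>\<^bsub>?M\<^esub> y) \<subseteq> carrier G"
    proof (induction x rule: frag_induction)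
      case (one s)
      from y have "Poly_Mapping.keys y \<subseteq> carrier G" by simp
      then show ?case
      proof (induction y rule: frag_induction)
        case (diff a b)
        then show ?case
          using keys_diff[of "frag_of s \<otimes>\<^bsub>?M\<^esub> a" "frag_of s \<otimes>\<^bsub>?M\<^esub> b"]
          by (auto simp: int_monoid_ring_mult_diff)
      qed (use one in auto)
    next
      case (diff a b)
      then show ?case using keys_diff[of "a \<otimes>\<^bsub>?M\<^esub> y" "b \<otimes>\<^bsub>?M\<^esub> y"]
        by (auto simp: int_monoid_ring_mult_diff)
    qed auto
    then show ?thesis by simp
  qed
  have comm: "x \<otimes>\<^bsub>?M\<^esub> y = y \<otimes>\<^bsub>?M\<^esub> x" if x: "x \<in> carrier ?M" and y: "y \<in> carrier ?M" for x y
  proof -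
    from x have "Poly_Mapping.keys x \<subseteq> carrier G" by simp
    then show ?thesis
    proof (induction x rule: frag_induction)
      case (one s)
      from y have "Poly_Mapping.keys y \<subseteq> carrier G" by simp
      then show ?case
        by (induction y rule: frag_induction)
          (use one in \<open>auto simp: int_monoid_ring_mult_diff G.m_comm\<close>)
    qed (auto simp: int_monoid_ring_mult_diff)
  qed
  have assoc: "x \<otimes>\<^bsub>?M\<^esub> y \<otimes>\<^bsub>?M\<^esub> z = x \<otimes>\<^bsub>?M\<^esub> (y \<otimes>\<^bsub>?M\<^esub> z)"
    if x: "x \<in> carrier ?M" and y: "y \<in> carrier ?M" and z: "z \<in> carrier ?M" for x y z
  proof -
    from x have "Poly_Mapping.keys x \<subseteq> carrier G" by simp
    then show ?thesis
    proof (induction x rule: frag_induction)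
      case (one s)
      from y have "Poly_Mapping.keys y \<subseteq> carrier G" by simp
      then show ?case
      proof (induction y rule: frag_induction)
        case (one t)
        from z have "Poly_Mapping.keys z \<subseteq> carrier G" by simp
        then show ?case
          by (induction z rule: frag_induction)
            (use one \<open>s \<in> carrier G\<close> in \<open>auto simp: int_monoid_ring_mult_diff G.m_assoc\<close>)
      qed (auto simp: int_monoid_ring_mult_diff)
    qed (auto simp: int_monoid_ring_mult_diff)
  qed
  have unit: "\<one>\<^bsub>?M\<^esub> \<otimes>\<^bsub>?M\<^esub> x = x" if "x \<in> carrier ?M" for x
  proof -
    from that have "Poly_Mapping.keys x \<subseteq> carrier G" by simp
    then show ?thesis
      by (induction x rule: frag_induction) (auto simp: int_monoid_ring_mult_diff)
  qed
  show ?thesis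
  proof (rule cringI)
    show "abelian_group ?M"
    proof (rule abelian_groupI)
      fix x assume "x \<in> carrier ?M"
      then show "\<exists>y\<in>carrier ?M. y \<oplus>\<^bsub>?M\<^esub> x = \<zero>\<^bsub>?M\<^esub>"
        by (intro bexI[of _ "- x"]) auto
    qed (auto dest!: subsetD[OF keys_add])
    show "comm_monoid ?M"
      by (rule comm_monoidI) (use closed comm assoc unit in auto)
  qed (simp add: int_monoid_ring_l_distr)
qed

text \<open>Inverses in a ring record are definite descriptions over its carrier, so they agree with
  subtraction of finitely supported functions only for elements of the carrier.\<close>

lemma int_monoid_ring_minus [simp]:
  assumes "comm_monoid G" "x \<in> carrier (int_monoid_ring G)" "y \<in> carrier (int_monoid_ring G)"
  shows "\<ominus>\<^bsub>int_monoid_ring G\<^esub> x = - x" "x \<ominus>\<^bsub>int_monoid_ring G\<^esub> y = x - y"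
proof -
  interpret M: cring "int_monoid_ring G"
    by (rule cring_int_monoid_ring) fact
  have *: "\<ominus>\<^bsub>int_monoid_ring G\<^esub> x = - x" if "x \<in> carrier (int_monoid_ring G)" for x
    by (rule M.minus_equality) (use that in auto)
  show "\<ominus>\<^bsub>int_monoid_ring G\<^esub> x = - x" "x \<ominus>\<^bsub>int_monoid_ring G\<^esub> y = x - y"
    using assms by (auto simp: * M.minus_eq)
qed

text \<open>Freeness supplies the additive extension of \<open>w\<close>. Compatibility with
  products is additive in both factors, so it is checked on basis elements, where it is the
  homomorphism property of \<open>w\<close>.\<close>

lemma int_monoid_ring_universal:
  assumes G: "comm_monoid G" and E: "cring E"
    and w: "w \<in> hom G E" "w \<one>\<^bsub>G\<^esub> = \<one>\<^bsub>E\<^esub>"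
  obtains h where "h \<in> ring_hom (int_monoid_ring G) E"
    "\<And>s. s \<in> carrier G \<Longrightarrow> h (frag_of s) = w s"
proof -
  interpret G: comm_monoid G by fact
  interpret E: cring E by fact
  interpret M: cring "int_monoid_ring G"
    by (rule cring_int_monoid_ring) fact
  let ?M = "int_monoid_ring G"
  have wc: "w s \<in> carrier E" if "s \<in> carrier G" for s
    using w that by (auto simp: hom_def)
  then have "w ` carrier G \<subseteq> carrier (add_monoid E)" by auto
  from comm_group.free_Abelian_group_universal[OF E.a_comm_group this]
  obtain h where h: "h \<in> hom (free_Abelian_group (carrier G)) (add_monoid E)"
    and hw: "\<And>s. s \<in> carrier G \<Longrightarrow> h (frag_of s) = w s" by metis
  have hc: "h x \<in> carrier E" if "x \<in> carrier ?M" for x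
    using h that by (auto simp: hom_def)
  have hadd: "h (x + y) = h x \<oplus>\<^bsub>E\<^esub> h y" if "x \<in> carrier ?M" "y \<in> carrier ?M" for x y
    using h that by (auto simp: hom_def)
  have h0: "h 0 = \<zero>\<^bsub>E\<^esub>"
  proof -
    have "h 0 = h 0 \<oplus>\<^bsub>E\<^esub> h 0" using hadd[of 0 0] by simp
    then show ?thesis using hc[of 0] by (simp add: E.add.r_cancel_one')
  qed
  have hdiff: "h (x - y) = h x \<ominus>\<^bsub>E\<^esub> h y" if "x \<in> carrier ?M" "y \<in> carrier ?M" for x y
  proof -
    have "x - y \<in> carrier ?M" using M.minus_closed[OF that] that G by simp
    moreover from this have "h x = h (x - y) \<oplus>\<^bsub>E\<^esub> h y" using hadd[of "x - y" y] that by simp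
    ultimately show ?thesis using hc that by (simp add: E.minus_eq E.add.m_assoc E.r_neg)
  qed
  have "h \<in> ring_hom ?M E"
  proof (rule ring_hom_memI)
    fix x y assume x: "x \<in> carrier ?M" and y: "y \<in> carrier ?M"
    from x have "Poly_Mapping.keys x \<subseteq> carrier G" by simp
    \<comment> \<open>The support condition is part of the induction claim because the difference
      case of \<open>frag_induction\<close> says nothing about the supports of the two parts, and
      \<open>hdiff\<close> needs both in the carrier.\<close>
    then have "Poly_Mapping.keys x \<subseteq> carrier G \<and> h (x \<otimes>\<^bsub>?M\<^esub> y) = h x \<otimes>\<^bsub>E\<^esub> h y"
    proof (induction x rule: frag_induction)
      case (one s)
      from y have "Poly_Mapping.keys y \<subseteq> carrier G" by simp
      then have "Poly_Mapping.keys y \<subseteq> carrier G \<and>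
        h (frag_of s \<otimes>\<^bsub>?M\<^esub> y) = h (frag_of s) \<otimes>\<^bsub>E\<^esub> h y"
      proof (induction y rule: frag_induction)
        case (one t)
        then show ?case using \<open>s \<in> carrier G\<close> w(1) by (auto simp: hw hom_def)
      next
        case (diff a b)
        then have ab: "frag_of s \<in> carrier ?M" "a \<in> carrier ?M" "b \<in> carrier ?M"
          using \<open>s \<in> carrier G\<close> by auto
        then have "h (frag_of s \<otimes>\<^bsub>?M\<^esub> (a - b)) = h (frag_of s) \<otimes>\<^bsub>E\<^esub> h (a - b)"
          using diff hc[OF ab(1)] hc[OF ab(2)] hc[OF ab(3)]
          by (simp only: int_monoid_ring_mult_diff hdiff M.m_closed E.r_distr E.minus_eq
              E.r_minus E.a_inv_closed)
        then show ?case using diff keys_diff[of a b] by auto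
      qed (use \<open>s \<in> carrier G\<close> in \<open>auto simp: h0 hw wc\<close>)
      then show ?case using one by simp
    next
      case (diff a b)
      then have ab: "a \<in> carrier ?M" "b \<in> carrier ?M" by auto
      then have "h ((a - b) \<otimes>\<^bsub>?M\<^esub> y) = h (a - b) \<otimes>\<^bsub>E\<^esub> h y"
        using diff hc[OF ab(1)] hc[OF ab(2)] hc[OF y] y
        by (simp only: int_monoid_ring_mult_diff hdiff M.m_closed E.l_distr E.minus_eq
            E.l_minus E.a_inv_closed)
      then show ?case using diff keys_diff[of a b] by auto
    qed (use y hc in \<open>auto simp: h0\<close>)
    then show "h (x \<otimes>\<^bsub>?M\<^esub> y) = h x \<otimes>\<^bsub>E\<^esub> h y" by simp
  qed (use hc hadd w hw in auto)
  with hw show ?thesis by (intro that)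
qed

lemma comm_monoid_DirProd:
  assumes "comm_monoid G" "comm_monoid H"
  shows "comm_monoid (G \<times>\<times> H)"
proof -
  interpret G: comm_monoid G by fact
  interpret H: comm_monoid H by fact
  show ?thesis
    by (rule comm_monoidI) (auto simp: G.m_assoc H.m_assoc intro: G.m_comm H.m_comm)
qed

section \<open>The ring structure of tensor products\<close>

text \<open>\<open>B\<close> enters only as the index set of the balancing relations, so it may be
  an arbitrary record. Below it is instantiated with \<open>base\<close> and \<open>\<Delta>\<close>
  without first showing that these are rings.\<close>

locale tensor_product = C: cring C + D: cring D
  for B :: "('b, 'x) ring_scheme" and C :: "('c, 'y) ring_scheme" and D :: "('d, 'z) ring_scheme" +
  fixes f :: "'b \<Rightarrow> 'c" and g :: "'b \<Rightarrow> 'd"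
  assumes f_closed: "b \<in> carrier B \<Longrightarrow> f b \<in> carrier C"
    and g_closed: "b \<in> carrier B \<Longrightarrow> g b \<in> carrier D"
begin

abbreviation "MR \<equiv> int_monoid_ring (C \<times>\<times> D)"
abbreviation "TI \<equiv> tensor_ideal B C D f g"
abbreviation "TA \<equiv> tensor_alg B C D f g"
abbreviation "pt \<equiv> pure_tensor B C D f g"

lemma comm_monoid_factors: "comm_monoid (C \<times>\<times> D)"
  by (intro comm_monoid_DirProd C.comm_monoid_axioms D.comm_monoid_axioms)

sublocale M: cring MR
  by (intro cring_int_monoid_ring comm_monoid_factors)

definition relators :: "('c \<times> 'd \<Rightarrow>\<^sub>0 int) set" where
  "relators = {frag_of (c \<oplus>\<^bsub>C\<^esub> c', d) - frag_of (c, d) - frag_of (c', d) | c c' d.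
         c \<in> carrier C \<and> c' \<in> carrier C \<and> d \<in> carrier D}
    \<union> {frag_of (c, d \<oplus>\<^bsub>D\<^esub> d') - frag_of (c, d) - frag_of (c, d') | c d d'.
         c \<in> carrier C \<and> d \<in> carrier D \<and> d' \<in> carrier D}
    \<union> {frag_of (c \<otimes>\<^bsub>C\<^esub> f b, d) - frag_of (c, g b \<otimes>\<^bsub>D\<^esub> d) | b c d.
         b \<in> carrier B \<and> c \<in> carrier C \<and> d \<in> carrier D}"

lemma frag_of_closed:
  "c \<in> carrier C \<Longrightarrow> d \<in> carrier D \<Longrightarrow> frag_of (c, d) \<in> carrier MR"
  by simp

lemma diff_closed:
  "x \<in> carrier MR \<Longrightarrow> y \<in> carrier MR \<Longrightarrow> x - y \<in> carrier MR"
  using M.minus_closed[of x y] int_monoid_ring_minus[OF comm_monoid_factors, of x y] by simp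

lemma relators_subset: "relators \<subseteq> carrier MR"
proof
  fix x assume "x \<in> relators"
  then show "x \<in> carrier MR"
    unfolding relators_def
    by (elim UnE CollectE exE conjE; hypsubst)
      (intro diff_closed frag_of_closed; use f_closed g_closed in auto)+
qed

lemma tensor_ideal_eq: "TI = Idl\<^bsub>MR\<^esub> relators"
  by (simp add: tensor_ideal_def relators_def)

sublocale I: ideal TI MR
  unfolding tensor_ideal_eq by (intro M.genideal_ideal relators_subset)

sublocale T: cring TA
  unfolding tensor_alg_def by (rule I.quotient_is_cring) (rule M.is_cring)

definition proj :: "('c \<times> 'd \<Rightarrow>\<^sub>0 int) \<Rightarrow> ('c, 'd) tensor" where
  "proj x = TI +>\<^bsub>MR\<^esub> x"

lemma proj_hom: "proj \<in> ring_hom MR TA"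
  unfolding proj_def[abs_def] tensor_alg_def by (rule I.rcos_ring_hom)

sublocale P: ring_hom_cring MR TA proj
  by unfold_locales (rule proj_hom)

lemma proj_surj: "z \<in> carrier TA \<Longrightarrow> \<exists>x\<in>carrier MR. z = proj x"
  unfolding tensor_alg_def FactRing_def proj_def
  by (auto simp: A_RCOSETS_def' simp del: int_monoid_ring_simps)

lemma proj_eq_iff:
  "x \<in> carrier MR \<Longrightarrow> y \<in> carrier MR \<Longrightarrow> proj x = proj y \<longleftrightarrow> x \<ominus>\<^bsub>MR\<^esub> y \<in> TI"
  unfolding proj_def using M.quotient_eq_iff_same_a_r_cos[OF I.is_ideal] by blast

lemma pt_eq_proj: "pt c d = proj (frag_of (c, d))"
  by (simp add: pure_tensor_def proj_def)

lemma pt_closed [simp, intro]: "c \<in> carrier C \<Longrightarrow> d \<in> carrier D \<Longrightarrow> pt c d \<in> carrier TA"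
  unfolding pt_eq_proj by (intro P.hom_closed frag_of_closed)

lemma proj_relator: "x - y \<in> relators \<Longrightarrow> x \<in> carrier MR \<Longrightarrow> y \<in> carrier MR \<Longrightarrow> proj x = proj y"
  using M.genideal_self[OF relators_subset] int_monoid_ring_minus[OF comm_monoid_factors, of x y]
  by (auto simp: proj_eq_iff tensor_ideal_eq)

lemma add_closed:
  "x \<in> carrier MR \<Longrightarrow> y \<in> carrier MR \<Longrightarrow> x + y \<in> carrier MR"
  using M.a_closed[of x y] by simp

lemma pt_add_left:
  assumes "c \<in> carrier C" "c' \<in> carrier C" "d \<in> carrier D"
  shows "pt (c \<oplus>\<^bsub>C\<^esub> c') d = pt c d \<oplus>\<^bsub>TA\<^esub> pt c' d"
proof -
  have "frag_of (c \<oplus>\<^bsub>C\<^esub> c', d) - (frag_of (c, d) + frag_of (c', d)) \<in> relators"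
    using assms unfolding relators_def by (intro UnI1 CollectI exI[of _ c] exI[of _ c'] exI[of _ d]) simp
  then have "proj (frag_of (c \<oplus>\<^bsub>C\<^esub> c', d)) = proj (frag_of (c, d) + frag_of (c', d))"
    by (rule proj_relator; intro add_closed frag_of_closed; use assms in simp)
  then show ?thesis
    using P.hom_add[of "frag_of (c, d)" "frag_of (c', d)"] assms by (simp add: pt_eq_proj)
qed

lemma pt_add_right:
  assumes "c \<in> carrier C" "d \<in> carrier D" "d' \<in> carrier D"
  shows "pt c (d \<oplus>\<^bsub>D\<^esub> d') = pt c d \<oplus>\<^bsub>TA\<^esub> pt c d'"
proof -
  have "frag_of (c, d \<oplus>\<^bsub>D\<^esub> d') - (frag_of (c, d) + frag_of (c, d')) \<in> relators"
    using assms unfolding relators_def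
    by (intro UnI1 UnI2 CollectI exI[of _ c] exI[of _ d] exI[of _ d']) simp
  then have "proj (frag_of (c, d \<oplus>\<^bsub>D\<^esub> d')) = proj (frag_of (c, d) + frag_of (c, d'))"
    by (rule proj_relator; intro add_closed frag_of_closed; use assms in simp)
  then show ?thesis
    using P.hom_add[of "frag_of (c, d)" "frag_of (c, d')"] assms by (simp add: pt_eq_proj)
qed

lemma pt_balanced:
  assumes "b \<in> carrier B" "c \<in> carrier C" "d \<in> carrier D"
  shows "pt (c \<otimes>\<^bsub>C\<^esub> f b) d = pt c (g b \<otimes>\<^bsub>D\<^esub> d)"
proof -
  have "frag_of (c \<otimes>\<^bsub>C\<^esub> f b, d) - frag_of (c, g b \<otimes>\<^bsub>D\<^esub> d) \<in> relators"
    using assms unfolding relators_def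
    by (intro UnI2 CollectI exI[of _ b] exI[of _ c] exI[of _ d]) simp
  then show ?thesis
    unfolding pt_eq_proj
    by (rule proj_relator; intro frag_of_closed; use assms f_closed g_closed in simp)
qed

lemma pt_mult:
  assumes "c \<in> carrier C" "d \<in> carrier D" "c' \<in> carrier C" "d' \<in> carrier D"
  shows "pt c d \<otimes>\<^bsub>TA\<^esub> pt c' d' = pt (c \<otimes>\<^bsub>C\<^esub> c') (d \<otimes>\<^bsub>D\<^esub> d')"
  using P.hom_mult[of "frag_of (c, d)" "frag_of (c', d')"] assms by (simp add: pt_eq_proj)

lemma pt_one: "pt \<one>\<^bsub>C\<^esub> \<one>\<^bsub>D\<^esub> = \<one>\<^bsub>TA\<^esub>"
  using P.hom_one by (simp add: pt_eq_proj)

lemma pt_zero_left: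
  assumes "d \<in> carrier D"
  shows "pt \<zero>\<^bsub>C\<^esub> d = \<zero>\<^bsub>TA\<^esub>"
  using pt_add_left[of "\<zero>\<^bsub>C\<^esub>" "\<zero>\<^bsub>C\<^esub>" d] assms by (simp add: T.add.r_cancel_one')

lemma pt_minus_left:
  assumes "c \<in> carrier C" "d \<in> carrier D"
  shows "pt (\<ominus>\<^bsub>C\<^esub> c) d = \<ominus>\<^bsub>TA\<^esub> pt c d"
proof -
  have "pt (\<ominus>\<^bsub>C\<^esub> c) d \<oplus>\<^bsub>TA\<^esub> pt c d = \<zero>\<^bsub>TA\<^esub>"
    using pt_add_left[of "\<ominus>\<^bsub>C\<^esub> c" c d] assms by (simp add: C.l_neg pt_zero_left)
  then show ?thesis using assms by (simp add: T.minus_equality)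
qed

text \<open>Negatives need no case of their own: by \<open>pt_minus_left\<close> the negative of a
  pure tensor is pure. The induction over the free group carries \<open>P\<close> for an element and
  its negative together.\<close>

lemma tensor_induct [consumes 1, case_names pure add]:
  assumes "z \<in> carrier TA"
    and pure: "\<And>c d. c \<in> carrier C \<Longrightarrow> d \<in> carrier D \<Longrightarrow> P (pt c d)"
    and add: "\<And>x y. x \<in> carrier TA \<Longrightarrow> y \<in> carrier TA \<Longrightarrow> P x \<Longrightarrow> P y \<Longrightarrow> P (x \<oplus>\<^bsub>TA\<^esub> y)"
  shows "P z"
proof -
  obtain x where x: "x \<in> carrier MR" "z = proj x" using proj_surj assms(1) by blast
  from x(1) have "Poly_Mapping.keys x \<subseteq> carrier (C \<times>\<times> D)" by simp
  then have "x \<in> carrier MR \<and> P (proj x) \<and> P (\<ominus>\<^bsub>TA\<^esub> proj x)"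
  proof (induction x rule: frag_induction)
    case zero
    have "P \<zero>\<^bsub>TA\<^esub>" using pure[of "\<zero>\<^bsub>C\<^esub>" "\<zero>\<^bsub>D\<^esub>"] by (simp add: pt_zero_left)
    moreover have "proj 0 = \<zero>\<^bsub>TA\<^esub>" using P.hom_zero by simp
    ultimately show ?case by simp
  next
    case (one s)
    then obtain c d where s: "s = (c, d)" "c \<in> carrier C" "d \<in> carrier D" by auto
    with pure[of c d] pure[of "\<ominus>\<^bsub>C\<^esub> c" d] one show ?case
      by (simp add: pt_minus_left flip: pt_eq_proj)
  next
    case (diff a b)
    then have ab: "a \<in> carrier MR" "b \<in> carrier MR" by auto
    then have "a - b = a \<ominus>\<^bsub>MR\<^esub> b"
      using int_monoid_ring_minus[OF comm_monoid_factors] by simp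
    then have eq: "proj (a - b) = proj a \<oplus>\<^bsub>TA\<^esub> \<ominus>\<^bsub>TA\<^esub> proj b"
      using ab by (simp only: M.minus_eq P.hom_add P.hom_a_inv M.a_inv_closed)
    moreover have "\<ominus>\<^bsub>TA\<^esub> (proj a \<oplus>\<^bsub>TA\<^esub> \<ominus>\<^bsub>TA\<^esub> proj b) = \<ominus>\<^bsub>TA\<^esub> proj a \<oplus>\<^bsub>TA\<^esub> proj b"
      using P.hom_closed[OF ab(1)] P.hom_closed[OF ab(2)] by (simp add: T.minus_add)
    moreover have "proj a \<in> carrier TA" "proj b \<in> carrier TA" using ab P.hom_closed by blast+
    ultimately show ?case using diff diff_closed[OF ab] by (auto intro: add)
  qed
  with x show ?thesis by simp
qed

text \<open>The extension to \<open>MR\<close> kills the relators. Its kernel is an ideal, so it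
  kills the ideal that they generate and descends to the quotient.\<close>

lemma tensor_universal:
  assumes E: "cring E" and u: "u \<in> ring_hom C E" and v: "v \<in> ring_hom D E"
    and uv: "\<And>b. b \<in> carrier B \<Longrightarrow> u (f b) = v (g b)"
  obtains h where "h \<in> ring_hom TA E"
    "\<And>c d. c \<in> carrier C \<Longrightarrow> d \<in> carrier D \<Longrightarrow> h (pt c d) = u c \<otimes>\<^bsub>E\<^esub> v d"
proof -
  interpret E: cring E by fact
  interpret u: ring_hom_cring C E u by unfold_locales fact
  interpret v: ring_hom_cring D E v by unfold_locales fact
  let ?w = "\<lambda>(c, d). u c \<otimes>\<^bsub>E\<^esub> v d"
  have "?w \<in> hom (C \<times>\<times> D) E"
    by (rule homI) (auto simp: E.m_ac)
  moreover have "?w \<one>\<^bsub>C \<times>\<times> D\<^esub> = \<one>\<^bsub>E\<^esub>" by simp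
  ultimately obtain h where h: "h \<in> ring_hom MR E"
    and hw: "\<And>s. s \<in> carrier (C \<times>\<times> D) \<Longrightarrow> h (frag_of s) = ?w s"
    using int_monoid_ring_universal[OF comm_monoid_factors E] by blast
  interpret h: ring_hom_cring MR E h by unfold_locales fact
  have h_ring: "ring_hom_ring MR E h" by unfold_locales (rule h)
  have hfrag: "h (frag_of (c, d)) = u c \<otimes>\<^bsub>E\<^esub> v d" if "c \<in> carrier C" "d \<in> carrier D" for c d
    using hw[of "(c, d)"] that by simp
  have hdiff: "h (x - y) = h x \<ominus>\<^bsub>E\<^esub> h y" if "x \<in> carrier MR" "y \<in> carrier MR" for x y
  proof -
    have "x - y = x \<ominus>\<^bsub>MR\<^esub> y" using int_monoid_ring_minus[OF comm_monoid_factors] that by simp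
    then show ?thesis using that by (simp only: M.minus_eq E.minus_eq h.hom_add h.hom_a_inv M.a_inv_closed)
  qed
  have rel: "h x = \<zero>\<^bsub>E\<^esub>" if "x \<in> relators" for x
    using that unfolding relators_def
  proof (elim UnE CollectE exE conjE)
    fix c c' d assume x: "x = frag_of (c \<oplus>\<^bsub>C\<^esub> c', d) - frag_of (c, d) - frag_of (c', d)"
      and cd: "c \<in> carrier C" "c' \<in> carrier C" "d \<in> carrier D"
    have "h x = h (frag_of (c \<oplus>\<^bsub>C\<^esub> c', d)) \<ominus>\<^bsub>E\<^esub> h (frag_of (c, d)) \<ominus>\<^bsub>E\<^esub> h (frag_of (c', d))"
      unfolding x using cd by (simp add: hdiff diff_closed frag_of_closed del: int_monoid_ring_simps)
    also have "\<dots> = u (c \<oplus>\<^bsub>C\<^esub> c') \<otimes>\<^bsub>E\<^esub> v d \<ominus>\<^bsub>E\<^esub> u c \<otimes>\<^bsub>E\<^esub> v d \<ominus>\<^bsub>E\<^esub> u c' \<otimes>\<^bsub>E\<^esub> v d"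
      using cd by (simp add: hfrag)
    also have "\<dots> = \<zero>\<^bsub>E\<^esub>"
      using cd u.hom_closed[of c] u.hom_closed[of c'] v.hom_closed[of d] by (simp, algebra)
    finally show ?thesis .
  next
    fix c d d' assume x: "x = frag_of (c, d \<oplus>\<^bsub>D\<^esub> d') - frag_of (c, d) - frag_of (c, d')"
      and cd: "c \<in> carrier C" "d \<in> carrier D" "d' \<in> carrier D"
    have "h x = h (frag_of (c, d \<oplus>\<^bsub>D\<^esub> d')) \<ominus>\<^bsub>E\<^esub> h (frag_of (c, d)) \<ominus>\<^bsub>E\<^esub> h (frag_of (c, d'))"
      unfolding x using cd by (simp add: hdiff diff_closed frag_of_closed del: int_monoid_ring_simps)
    also have "\<dots> = u c \<otimes>\<^bsub>E\<^esub> v (d \<oplus>\<^bsub>D\<^esub> d') \<ominus>\<^bsub>E\<^esub> u c \<otimes>\<^bsub>E\<^esub> v d \<ominus>\<^bsub>E\<^esub> u c \<otimes>\<^bsub>E\<^esub> v d'"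
      using cd by (simp add: hfrag)
    also have "\<dots> = \<zero>\<^bsub>E\<^esub>"
      using cd u.hom_closed[of c] v.hom_closed[of d] v.hom_closed[of d'] by (simp, algebra)
    finally show ?thesis .
  next
    fix b c d assume x: "x = frag_of (c \<otimes>\<^bsub>C\<^esub> f b, d) - frag_of (c, g b \<otimes>\<^bsub>D\<^esub> d)"
      and cd: "b \<in> carrier B" "c \<in> carrier C" "d \<in> carrier D"
    have "h x = h (frag_of (c \<otimes>\<^bsub>C\<^esub> f b, d)) \<ominus>\<^bsub>E\<^esub> h (frag_of (c, g b \<otimes>\<^bsub>D\<^esub> d))"
      unfolding x using cd f_closed g_closed
      by (simp add: hdiff frag_of_closed del: int_monoid_ring_simps)
    also have "\<dots> = \<zero>\<^bsub>E\<^esub>"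
      using cd f_closed g_closed by (simp add: hfrag uv E.m_assoc)
    finally show ?thesis .
  qed
  have "relators \<subseteq> a_kernel MR E h"
  proof
    fix x assume "x \<in> relators"
    with rel relators_subset show "x \<in> a_kernel MR E h"
      unfolding a_kernel_def' by blast
  qed
  then have ker: "h x = \<zero>\<^bsub>E\<^esub>" if "x \<in> TI" for x
    using M.genideal_minimal[OF ring_hom_ring.kernel_is_ideal[OF h_ring], of relators] that
    unfolding tensor_ideal_eq a_kernel_def' by blast
  \<comment> \<open>\<open>H\<close> evaluates \<open>h\<close> at a chosen representative of the
    coset; since \<open>h\<close> vanishes on \<open>TI\<close>, the choice does not matter.\<close>
  define H where "H z = h (SOME x. x \<in> carrier MR \<and> z = proj x)" for z
  have H: "H (proj x) = h x" if x: "x \<in> carrier MR" for x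
  proof -
    let ?y = "SOME y. y \<in> carrier MR \<and> proj x = proj y"
    have y: "?y \<in> carrier MR \<and> proj x = proj ?y" using x by (intro someI[of "\<lambda>y. y \<in> carrier MR \<and> proj x = proj y" x] conjI refl)
    then have "x \<ominus>\<^bsub>MR\<^esub> ?y \<in> TI" using x proj_eq_iff[of x ?y] by blast
    then have "h (x \<ominus>\<^bsub>MR\<^esub> ?y) = \<zero>\<^bsub>E\<^esub>" by (rule ker)
    then have "h x \<ominus>\<^bsub>E\<^esub> h ?y = \<zero>\<^bsub>E\<^esub>"
      using x y by (simp only: M.minus_eq E.minus_eq h.hom_add h.hom_a_inv M.a_inv_closed)
    then have "h x = h ?y"
      using E.r_right_minus_eq[OF h.hom_closed[OF x] h.hom_closed[OF conjunct1[OF y]]] by blast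
    then show ?thesis by (simp add: H_def)
  qed
  have Hhom: "H \<in> ring_hom TA E"
  proof (rule ring_hom_memI)
    fix z z' assume zc: "z \<in> carrier TA" "z' \<in> carrier TA"
    obtain x x' where x: "x \<in> carrier MR" "x' \<in> carrier MR" and z: "z = proj x" "z' = proj x'"
      using proj_surj[OF zc(1)] proj_surj[OF zc(2)] by (elim bexE)
    show "H z \<in> carrier E" unfolding z using x by (simp only: H h.hom_closed)
    show "H (z \<otimes>\<^bsub>TA\<^esub> z') = H z \<otimes>\<^bsub>E\<^esub> H z'"
      unfolding z using x by (simp only: H h.hom_mult M.m_closed flip: P.hom_mult)
    show "H (z \<oplus>\<^bsub>TA\<^esub> z') = H z \<oplus>\<^bsub>E\<^esub> H z'"
      unfolding z using x by (simp only: H h.hom_add M.a_closed flip: P.hom_add)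
  next
    show "H \<one>\<^bsub>TA\<^esub> = \<one>\<^bsub>E\<^esub>" using H[OF M.one_closed] by (simp only: P.hom_one h.hom_one)
  qed
  have Hpt: "H (pt c d) = u c \<otimes>\<^bsub>E\<^esub> v d" if "c \<in> carrier C" "d \<in> carrier D" for c d
    unfolding pt_eq_proj using that by (simp only: H frag_of_closed hfrag)
  show ?thesis by (rule that[OF Hhom Hpt])
qed

lemma pt_decompose:
  assumes "c \<in> carrier C" "d \<in> carrier D"
  shows "pt c d = pt c \<one>\<^bsub>D\<^esub> \<otimes>\<^bsub>TA\<^esub> pt \<one>\<^bsub>C\<^esub> d"
  using assms by (simp add: pt_mult)

lemma tensor_hom_eq:
  assumes h: "h \<in> ring_hom TA E" and k: "k \<in> ring_hom TA E"
    and l: "\<And>c. c \<in> carrier C \<Longrightarrow> h (pt c \<one>\<^bsub>D\<^esub>) = k (pt c \<one>\<^bsub>D\<^esub>)"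
    and r: "\<And>d. d \<in> carrier D \<Longrightarrow> h (pt \<one>\<^bsub>C\<^esub> d) = k (pt \<one>\<^bsub>C\<^esub> d)"
    and z: "z \<in> carrier TA"
  shows "h z = k z"
  using z
proof (induction z rule: tensor_induct)
  case (pure c d)
  then show ?case
    using l r by (simp add: pt_decompose[of c d] ring_hom_mult[OF h] ring_hom_mult[OF k])
qed (simp add: ring_hom_add[OF h] ring_hom_add[OF k])

lemma inclusion_left: "(\<lambda>c. pt c \<one>\<^bsub>D\<^esub>) \<in> ring_hom C TA"
  by (rule ring_hom_memI) (auto simp: pt_mult pt_add_left pt_one)

lemma inclusion_right: "(\<lambda>d. pt \<one>\<^bsub>C\<^esub> d) \<in> ring_hom D TA"
  by (rule ring_hom_memI) (auto simp: pt_mult pt_add_right pt_one)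

text \<open>Restricting the map of the universal property to the carrier makes it extensional. By
  \<open>tensor_hom_eq\<close> it is then the only candidate, so the description in
  \<open>tensor_copair\<close> picks it.\<close>

lemma tensor_copair:
  assumes E: "cring E" and u: "u \<in> ring_hom C E" and v: "v \<in> ring_hom D E"
    and uv: "\<And>b. b \<in> carrier B \<Longrightarrow> u (f b) = v (g b)"
  shows "tensor_copair B C D f g E u v \<in> ring_hom TA E \<inter> extensional (carrier TA)"
    and "c \<in> carrier C \<Longrightarrow> d \<in> carrier D \<Longrightarrow>
      tensor_copair B C D f g E u v (pt c d) = u c \<otimes>\<^bsub>E\<^esub> v d"
proof -
  interpret E: cring E by fact
  obtain h where h: "h \<in> ring_hom TA E"
    and hpt: "\<And>c d. c \<in> carrier C \<Longrightarrow> d \<in> carrier D \<Longrightarrow> h (pt c d) = u c \<otimes>\<^bsub>E\<^esub> v d"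
    using tensor_universal[OF E u v uv] by metis
  let ?h = "restrict h (carrier TA)"
  let ?P = "\<lambda>h. h \<in> ring_hom TA E \<inter> extensional (carrier TA)
       \<and> (\<forall>c\<in>carrier C. h (pt c \<one>\<^bsub>D\<^esub>) = u c) \<and> (\<forall>d\<in>carrier D. h (pt \<one>\<^bsub>C\<^esub> d) = v d)"
  have hom: "?h \<in> ring_hom TA E"
    by (rule T.ring_hom_restrict[OF h]) simp
  have P: "?P ?h"
    using hom u v by (auto simp: hpt ring_hom_one ring_hom_closed)
  moreover have "k = ?h" if "?P k" for k
  proof (rule extensionalityI)
    fix z assume "z \<in> carrier TA"
    then show "k z = ?h z" by (rule tensor_hom_eq[OF _ hom, rotated -1]) (use that P in auto)
  qed (use that in auto)
  ultimately have "tensor_copair B C D f g E u v = ?h"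
    unfolding tensor_copair_def by (rule the_equality)
  then show "tensor_copair B C D f g E u v \<in> ring_hom TA E \<inter> extensional (carrier TA)"
    "c \<in> carrier C \<Longrightarrow> d \<in> carrier D \<Longrightarrow>
      tensor_copair B C D f g E u v (pt c d) = u c \<otimes>\<^bsub>E\<^esub> v d"
    using P by (simp_all add: hpt)
qed

end

section \<open>Dual numbers and derivations\<close>

lemma type_ring_simps [simp]:
  "carrier (ring_of_type_algebra :: 'a::comm_ring_1 ring) = UNIV"
  "\<zero>\<^bsub>(ring_of_type_algebra :: 'a::comm_ring_1 ring)\<^esub> = 0"
  "\<one>\<^bsub>(ring_of_type_algebra :: 'a::comm_ring_1 ring)\<^esub> = 1"
  "x \<oplus>\<^bsub>(ring_of_type_algebra :: 'a::comm_ring_1 ring)\<^esub> y = x + y"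
  "x \<otimes>\<^bsub>(ring_of_type_algebra :: 'a::comm_ring_1 ring)\<^esub> y = x * y"
  by (simp_all add: ring_of_type_algebra_def)

lemma type_ring_cring: "cring (ring_of_type_algebra :: 'a::comm_ring_1 ring)"
  by (rule cring_from_type_algebra)

lemma type_ring_uminus [simp]:
  "\<ominus>\<^bsub>(ring_of_type_algebra :: 'a::comm_ring_1 ring)\<^esub> x = - x"
proof -
  interpret cring "ring_of_type_algebra :: 'a ring" by (rule type_ring_cring)
  show ?thesis by (rule minus_equality) auto
qed

lemma type_ring_minus [simp]:
  "x \<ominus>\<^bsub>(ring_of_type_algebra :: 'a::comm_ring_1 ring)\<^esub> y = x - y"
  by (simp add: a_minus_def)

lemma type_ring_inverse [simp]:
  fixes x :: "'a::field"
  assumes "x \<noteq> 0"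
  shows "inv\<^bsub>(ring_of_type_algebra :: 'a ring)\<^esub> x = inverse x"
proof -
  interpret field "ring_of_type_algebra :: 'a ring" by (rule field_from_type_algebra)
  show ?thesis using assms by (intro comm_inv_char) auto
qed

lemma type_ring_pow [simp]:
  "x [^]\<^bsub>(ring_of_type_algebra :: 'a::comm_ring_1 ring)\<^esub> (n::nat) = x ^ n"
  by (induction n) (simp_all add: nat_pow_def mult.commute)

text \<open>The reference model of the dual numbers, with \<open>eps\<close> the coefficient of S.
  Being a type class instance, it lets ring identities be checked coordinatewise by the
  simplifier.\<close>

datatype 'a dual = Dual (re: 'a) (eps: 'a)

instantiation dual :: (comm_ring_1) comm_ring_1
begin

definition "0 = Dual 0 0"
definition "1 = Dual 1 0"
definition "x + y = Dual (re x + re y) (eps x + eps y)"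
definition "- x = Dual (- re x) (- eps x)"
definition "x - y = Dual (re x - re y) (eps x - eps y)"
definition "x * y = Dual (re x * re y) (re x * eps y + eps x * re y)"

instance
  by standard
    (auto simp: zero_dual_def one_dual_def plus_dual_def uminus_dual_def minus_dual_def
      times_dual_def algebra_simps)

end

lemma dual_simps [simp]:
  "re 0 = 0" "eps 0 = 0" "re 1 = 1" "eps 1 = 0"
  "re (x + y) = re x + re y" "eps (x + y) = eps x + eps y"
  "re (- x) = - re x" "eps (- x) = - eps x"
  "re (x - y) = re x - re y" "eps (x - y) = eps x - eps y"
  "re (x * y) = re x * re y" "eps (x * y) = re x * eps y + eps x * re y"
  by (simp_all add: zero_dual_def one_dual_def plus_dual_def uminus_dual_def minus_dual_def
      times_dual_def)

lemma dual_eq_iff: "x = y \<longleftrightarrow> re x = re y \<and> eps x = eps y"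
  by (cases x; cases y) simp

section \<open>Generators of \<open>K(T)\<close> and its derivation\<close>

lemma rat_const_simps [simp]:
  fixes a b :: "'k::field"
  shows "rat_const (0::'k) = 0" "rat_const (1::'k) = 1"
    "rat_const (a + b) = rat_const a + rat_const b" "rat_const (a * b) = rat_const a * rat_const b"
  by (simp_all add: rat_const_def flip: to_fract_add to_fract_mult one_pCons)

lemma rat_const_power [simp]: "rat_const (a ^ n) = rat_const a ^ n"
  by (induction n) simp_all

lemma rat_const_hom: "rat_const \<in> ring_hom (ring_of_type_algebra :: 'k::field ring) ratfun_field"
  by (rule ring_hom_memI) auto

lemma to_fract_pCons: "to_fract (pCons (a::'k::field) p) = rat_const a + rat_T * to_fract p"
proof -
  have "pCons a p = [:a:] + [:0, 1:] * p" by simp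
  then show ?thesis by (simp only: to_fract_add to_fract_mult rat_const_def rat_T_def)
qed

text \<open>\<open>K(T)\<close> is generated as a field by K and T: Horner's scheme builds every
  polynomial, and a fraction is a numerator times the inverse of a denominator.\<close>

lemma ratfun_induct [case_names const T add mult inverse]:
  fixes F :: "'k::field ratfun"
  assumes const: "\<And>k. P (rat_const k)" and T: "P rat_T"
    and add: "\<And>F G. P F \<Longrightarrow> P G \<Longrightarrow> P (F + G)"
    and mult: "\<And>F G. P F \<Longrightarrow> P G \<Longrightarrow> P (F * G)"
    and inverse: "\<And>F. P F \<Longrightarrow> F \<noteq> 0 \<Longrightarrow> P (inverse F)"
  shows "P F"
proof -
  have poly: "P (to_fract p)" for p :: "'k poly"
  proof (induction p)
    case 0
    then show ?case using const[of 0] by simp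
  next
    case (pCons a p)
    then show ?case by (auto simp: to_fract_pCons intro: const T add mult)
  qed
  obtain a b where "b \<noteq> 0" "F = Fract a b" by (cases F) auto
  then have "F = to_fract a * inverse (to_fract b)"
    by (simp add: Fract_conv_to_fract field_simps)
  with \<open>b \<noteq> 0\<close> show ?thesis by (auto intro!: mult poly inverse)
qed

text \<open>Inverses are unique in any commutative ring, so agreement passes to inverses even though
  the targets of interest have nilpotents.\<close>

lemma ratfun_hom_eq:
  fixes F :: "'k::field ratfun"
  assumes E: "cring E" and h: "h \<in> ring_hom ratfun_field E" and k: "k \<in> ring_hom ratfun_field E"
    and const: "\<And>a. h (rat_const a) = k (rat_const a)" and T: "h rat_T = k rat_T"
  shows "h F = k F"
proof (induction F rule: ratfun_induct)
  case (add F G)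
  then show ?case using ring_hom_add[OF h, of F G] ring_hom_add[OF k, of F G] by simp
next
  case (mult F G)
  then show ?case using ring_hom_mult[OF h, of F G] ring_hom_mult[OF k, of F G] by simp
next
  case (inverse F)
  interpret E: cring E by fact
  have closed: "h F \<in> carrier E" "h (inverse F) \<in> carrier E" "k (inverse F) \<in> carrier E"
    using ring_hom_closed[OF h, of F] ring_hom_closed[OF h, of "inverse F"]
      ring_hom_closed[OF k, of "inverse F"] by auto
  have "h F \<otimes>\<^bsub>E\<^esub> h (inverse F) = \<one>\<^bsub>E\<^esub>" "k F \<otimes>\<^bsub>E\<^esub> k (inverse F) = \<one>\<^bsub>E\<^esub>"
    using inverse ring_hom_mult[OF h, of F "inverse F"] ring_hom_mult[OF k, of F "inverse F"]
      ring_hom_one[OF h] ring_hom_one[OF k] by auto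
  then show ?case
    using inverse closed by (metis E.inv_unique E.m_comm)
qed (use const T in auto)

lemma rat_deriv_to_fract: "rat_deriv (to_fract p) = to_fract (pderiv p)"
  using rat_deriv_Fract[of 1 p] by (simp add: to_fract_def)

lemma rat_deriv_add: "rat_deriv (F + G) = rat_deriv F + rat_deriv G"
proof -
  obtain a b c d where "b \<noteq> 0" "F = Fract a b" "d \<noteq> 0" "G = Fract c d"
    by (cases F; cases G) auto
  then show ?thesis
    by (simp add: rat_deriv_Fract eq_fract pderiv_mult pderiv_add algebra_simps)
qed

lemma rat_deriv_mult: "rat_deriv (F * G) = F * rat_deriv G + rat_deriv F * G"
proof -
  obtain a b c d where "b \<noteq> 0" "F = Fract a b" "d \<noteq> 0" "G = Fract c d"
    by (cases F; cases G) auto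
  then show ?thesis
    by (simp add: rat_deriv_Fract eq_fract pderiv_mult pderiv_add algebra_simps)
qed

lemma rat_deriv_const [simp]: "rat_deriv (rat_const k) = 0"
  by (simp add: rat_const_def rat_deriv_to_fract)

lemma rat_deriv_T [simp]: "rat_deriv rat_T = 1"
  by (simp add: rat_T_def rat_deriv_to_fract pderiv_pCons flip: one_pCons)

lemma rat_deriv_0 [simp]: "rat_deriv 0 = 0" and rat_deriv_1 [simp]: "rat_deriv 1 = 0"
  using rat_deriv_const[of 0] rat_deriv_const[of 1] by simp_all

lemma rat_deriv_uminus: "rat_deriv (- F) = - rat_deriv F"
  using rat_deriv_add[of F "- F"] by (simp add: eq_neg_iff_add_eq_0 add.commute)

text \<open>The expansion \<open>F(T + c S) = F + c F' S\<close>, where \<open>S\<^sup>2 = 0\<close>.\<close>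
definition taylor :: "'k::field ratfun \<Rightarrow> 'k ratfun \<Rightarrow> 'k ratfun dual" where
  "taylor c F = Dual F (c * rat_deriv F)"

text \<open>In the \<open>eps\<close> coordinate, multiplicativity is exactly the Leibniz
  rule.\<close>

lemma taylor_hom: "taylor c \<in> ring_hom ratfun_field ring_of_type_algebra"
  by (rule ring_hom_memI)
    (auto simp: taylor_def dual_eq_iff rat_deriv_add rat_deriv_mult algebra_simps)

section \<open>Maps out of the dual numbers and rings isomorphic to them\<close>

locale dual_map = E: cring E for E :: "('e, 'm) ring_scheme" (structure) +
  fixes i :: "'k::comm_ring_1 \<Rightarrow> 'e" and s :: 'e
  assumes i_hom: "i \<in> ring_hom ring_of_type_algebra E"
    and s_closed [simp]: "s \<in> carrier E"
    and s_square: "s \<otimes> s = \<zero>"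
begin

definition of_dual :: "'k dual \<Rightarrow> 'e" where
  "of_dual d = i (re d) \<oplus> i (eps d) \<otimes> s"

lemma i_simps [simp]:
  "i a \<in> carrier E" "i 0 = \<zero>" "i 1 = \<one>" "i (a + b) = i a \<oplus> i b" "i (a * b) = i a \<otimes> i b"
proof -
  interpret i: ring_hom_cring ring_of_type_algebra E i
    by (intro ring_hom_cring.intro ring_hom_cring_axioms.intro type_ring_cring E.is_cring i_hom)
  show "i a \<in> carrier E" "i 0 = \<zero>" "i 1 = \<one>" "i (a + b) = i a \<oplus> i b" "i (a * b) = i a \<otimes> i b"
    using i.hom_closed[of a] i.hom_zero i.hom_one i.hom_add[of a b] i.hom_mult[of a b] by auto
qed

lemma of_dual_hom: "of_dual \<in> ring_hom ring_of_type_algebra E"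
proof (rule ring_hom_memI)
  fix x y :: "'k dual"
  \<comment> \<open>\<open>algebra\<close> knows only the ring axioms, so the multiple of
    \<open>s \<otimes> s\<close> is split off explicitly and removed afterwards with
    \<open>s_square\<close>.\<close>
  have "i (re x) \<otimes> i (re y) \<oplus> (i (re x) \<otimes> i (eps y) \<oplus> i (eps x) \<otimes> i (re y)) \<otimes> s =
    (i (re x) \<oplus> i (eps x) \<otimes> s) \<otimes> (i (re y) \<oplus> i (eps y) \<otimes> s) \<ominus> i (eps x) \<otimes> i (eps y) \<otimes> (s \<otimes> s)"
    using i_simps(1)[of "re x"] i_simps(1)[of "re y"] i_simps(1)[of "eps x"] i_simps(1)[of "eps y"]
      s_closed by algebra
  then show "of_dual (x \<otimes>\<^bsub>ring_of_type_algebra\<^esub> y) = of_dual x \<otimes> of_dual y"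
    by (simp add: of_dual_def s_square E.minus_eq)
  show "of_dual (x \<oplus>\<^bsub>ring_of_type_algebra\<^esub> y) = of_dual x \<oplus> of_dual y"
    by (simp add: of_dual_def E.l_distr E.a_ac)
qed (simp_all add: of_dual_def)

lemma of_dual_closed [simp]: "of_dual d \<in> carrier E"
  by (simp add: of_dual_def)

lemma of_dual_simps: "of_dual (Dual a 0) = i a" "of_dual (Dual 0 1) = s"
  by (simp_all add: of_dual_def)

end

text \<open>The common description of \<open>dual_alg\<close> over K and of \<open>rat_dual\<close>
  and Q over \<open>K(T)\<close>. Linear forms and isomorphisms are treated once, for an abstract
  model.\<close>

locale dual_model = dual_map E i s
  for E :: "('e, 'm) ring_scheme" (structure) and i :: "'k::comm_ring_1 \<Rightarrow> 'e" and s +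
  assumes bij: "bij_betw of_dual UNIV (carrier E)"
begin

definition to_dual :: "'e \<Rightarrow> 'k dual" where
  "to_dual = inv_into UNIV of_dual"

lemma to_of_dual [simp]: "to_dual (of_dual d) = d"
  using bij bij_betw_inv_into_left[of of_dual UNIV "carrier E" d]
  by (simp add: to_dual_def)

lemma of_to_dual [simp]: "x \<in> carrier E \<Longrightarrow> of_dual (to_dual x) = x"
  using bij bij_betw_inv_into_right[of of_dual UNIV "carrier E" x]
  by (simp add: to_dual_def)

lemma to_dual_simps [simp]: "to_dual (i a) = Dual a 0" "to_dual s = Dual 0 1"
  using to_of_dual[of "Dual a 0"] to_of_dual[of "Dual 0 1"] by (simp_all only: of_dual_simps)

lemma to_dual_hom: "to_dual \<in> ring_hom E ring_of_type_algebra"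
proof (rule ring_hom_memI)
  fix x y assume "x \<in> carrier E" "y \<in> carrier E"
  then have "x = of_dual (to_dual x)" "y = of_dual (to_dual y)" by simp_all
  then show "to_dual (x \<oplus> y) = to_dual x \<oplus>\<^bsub>ring_of_type_algebra\<^esub> to_dual y"
    "to_dual (x \<otimes> y) = to_dual x \<otimes>\<^bsub>ring_of_type_algebra\<^esub> to_dual y"
    using ring_hom_add[OF of_dual_hom, of "to_dual x" "to_dual y"]
      ring_hom_mult[OF of_dual_hom, of "to_dual x" "to_dual y"] to_of_dual
    by (metis UNIV_I type_ring_simps(1) type_ring_simps(4), metis UNIV_I type_ring_simps(1) type_ring_simps(5))
next
  show "to_dual \<one> = \<one>\<^bsub>ring_of_type_algebra\<^esub>"
    using to_dual_simps(1)[of 1] by (simp add: one_dual_def)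
qed simp

end

text \<open>The map \<open>\<sigma>\<close> is a left inverse of \<open>of_dual\<close>, so
  injectivity requires no knowledge of when two elements of \<open>E\<close> coincide. In the
  applications \<open>\<sigma>\<close> comes from a quotient map or a universal property.\<close>

lemma (in dual_map) dual_modelI:
  assumes \<sigma>: "\<sigma> \<in> ring_hom E ring_of_type_algebra" "\<And>a. \<sigma> (i a) = Dual a 0" "\<sigma> s = Dual 0 1"
    and span: "\<And>x. x \<in> carrier E \<Longrightarrow> \<exists>d. x = of_dual d"
  shows "dual_model E i s"
proof -
  have \<sigma>_of_dual: "\<sigma> (of_dual d) = d" for d
    using ring_hom_add[OF \<sigma>(1), of "i (re d)" "i (eps d) \<otimes> s"]
      ring_hom_mult[OF \<sigma>(1), of "i (eps d)" s]
    by (simp add: of_dual_def \<sigma>(2,3) dual_eq_iff)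
  have "bij_betw of_dual UNIV (carrier E)"
  proof (rule bij_betwI[where g = \<sigma>])
    show "of_dual (\<sigma> x) = x" if "x \<in> carrier E" for x
      using span[OF that] \<sigma>_of_dual by auto
  qed (use \<sigma>_of_dual in auto)
  then show ?thesis by unfold_locales
qed

section \<open>Linear forms and algebra maps on dual numbers\<close>

lemma alg_module_simps [simp]:
  "carrier (alg_module B i) = carrier B" "\<zero>\<^bsub>alg_module B i\<^esub> = \<zero>\<^bsub>B\<^esub>"
  "x \<oplus>\<^bsub>alg_module B i\<^esub> y = x \<oplus>\<^bsub>B\<^esub> y" "a \<odot>\<^bsub>alg_module B i\<^esub> x = i a \<otimes>\<^bsub>B\<^esub> x"
  by (simp_all add: alg_module_def)

lemma alg_module_minus [simp]:
  "\<ominus>\<^bsub>alg_module B i\<^esub> x = \<ominus>\<^bsub>B\<^esub> x" "x \<ominus>\<^bsub>alg_module B i\<^esub> y = x \<ominus>\<^bsub>B\<^esub> y"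
  by (simp_all add: alg_module_def a_minus_def a_inv_def m_inv_def)

lemma restrict_scalars_simps [simp]:
  "carrier (restrict_scalars \<phi> M) = carrier M" "\<zero>\<^bsub>restrict_scalars \<phi> M\<^esub> = \<zero>\<^bsub>M\<^esub>"
  "x \<oplus>\<^bsub>restrict_scalars \<phi> M\<^esub> y = x \<oplus>\<^bsub>M\<^esub> y"
  "a \<odot>\<^bsub>restrict_scalars \<phi> M\<^esub> x = \<phi> a \<odot>\<^bsub>M\<^esub> x"
  by (simp_all add: restrict_scalars_def)

lemma module_dsum_simps [simp]:
  "carrier (module_dsum M N) = carrier M \<times> carrier N"
  "\<zero>\<^bsub>module_dsum M N\<^esub> = (\<zero>\<^bsub>M\<^esub>, \<zero>\<^bsub>N\<^esub>)"
  "x \<oplus>\<^bsub>module_dsum M N\<^esub> y = (fst x \<oplus>\<^bsub>M\<^esub> fst y, snd x \<oplus>\<^bsub>N\<^esub> snd y)"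
  "a \<odot>\<^bsub>module_dsum M N\<^esub> x = (a \<odot>\<^bsub>M\<^esub> fst x, a \<odot>\<^bsub>N\<^esub> snd x)"
  by (simp_all add: module_dsum_def split: prod.split)

lemma pointwise_module_simps [simp]:
  "carrier (pointwise_module U N C) = C" "\<zero>\<^bsub>pointwise_module U N C\<^esub> = (\<lambda>x\<in>U. \<zero>\<^bsub>N\<^esub>)"
  "f \<oplus>\<^bsub>pointwise_module U N C\<^esub> g = (\<lambda>x\<in>U. f x \<oplus>\<^bsub>N\<^esub> g x)"
  "a \<odot>\<^bsub>pointwise_module U N C\<^esub> f = (\<lambda>x\<in>U. a \<odot>\<^bsub>N\<^esub> f x)"
  by (simp_all add: pointwise_module_def)

text \<open>The ring map \<open>\<phi>\<close> allows two uses: the identity for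
  \<open>K(T)\<close>-linear forms on \<open>rat_dual\<close>, and \<open>rat_const\<close> for
  K-linear forms on \<open>dual_alg\<close> with values in \<open>K(T)\<close>.\<close>

lemma (in dual_model) linear_form_iff:
  fixes \<phi> :: "'k \<Rightarrow> 'a::comm_ring_1"
  assumes \<phi>: "\<phi> \<in> ring_hom ring_of_type_algebra ring_of_type_algebra"
  shows "f \<in> carrier (hom_module ring_of_type_algebra \<phi> (alg_module E i)
      (alg_module ring_of_type_algebra (\<lambda>a. a))) \<longleftrightarrow>
    f \<in> extensional (carrier E) \<and> (\<exists>u v. \<forall>d. f (of_dual d) = \<phi> (re d) * u + \<phi> (eps d) * v)"
    (is "?L \<longleftrightarrow> ?R")
proof
  assume ?L
  then have ext: "f \<in> extensional (carrier E)"
    and add: "f (x \<oplus> y) = f x + f y" and smult: "f (i a \<otimes> x) = \<phi> a * f x"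
    if "x \<in> carrier E" "y \<in> carrier E" for x y a
    using that by (auto simp: hom_module_def mod_hom_def)
  have "f (of_dual d) = \<phi> (re d) * f \<one> + \<phi> (eps d) * f s" for d
    using add[of "i (re d) \<otimes> \<one>" "i (eps d) \<otimes> s"] smult[of \<one> \<one> "re d"] smult[of s s "eps d"]
    by (simp add: of_dual_def)
  with ext show ?R by blast
next
  assume ?R
  then obtain u v where ext: "f \<in> extensional (carrier E)"
    and f: "\<And>d. f (of_dual d) = \<phi> (re d) * u + \<phi> (eps d) * v" by blast
  have \<phi>_simps: "\<phi> (a + b) = \<phi> a + \<phi> b" "\<phi> (a * b) = \<phi> a * \<phi> b" for a b
    using ring_hom_add[OF \<phi>, of a b] ring_hom_mult[OF \<phi>, of a b] by auto
  have \<phi>_0: "\<phi> 0 = 0" using \<phi>_simps(1)[of 0 0] by simp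
  have "f (x \<oplus> y) = f x + f y" if "x \<in> carrier E" "y \<in> carrier E" for x y
    using f[of "to_dual x"] f[of "to_dual y"] f[of "to_dual x + to_dual y"] that
      ring_hom_add[OF of_dual_hom, of "to_dual x" "to_dual y"]
    by (simp add: \<phi>_simps algebra_simps)
  moreover have "f (i a \<otimes> x) = \<phi> a * f x" if "x \<in> carrier E" for x a
    using f[of "to_dual x"] f[of "Dual a 0 * to_dual x"] that
      ring_hom_mult[OF of_dual_hom, of "Dual a 0" "to_dual x"]
    by (simp add: \<phi>_simps \<phi>_0 of_dual_simps algebra_simps)
  ultimately show ?L using ext by (auto simp: hom_module_def mod_hom_def)
qed

lemma (in dual_model) linear_form_eq:
  fixes \<phi> :: "'k \<Rightarrow> 'a::comm_ring_1"
  assumes \<phi>: "\<phi> \<in> ring_hom ring_of_type_algebra ring_of_type_algebra"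
    and f: "f \<in> carrier (hom_module ring_of_type_algebra \<phi> (alg_module E i)
      (alg_module ring_of_type_algebra (\<lambda>a. a)))"
  shows "f (of_dual d) = \<phi> (re d) * f \<one> + \<phi> (eps d) * f s"
proof -
  obtain u v where uv: "\<And>d. f (of_dual d) = \<phi> (re d) * u + \<phi> (eps d) * v"
    using f linear_form_iff[OF \<phi>] by blast
  have "\<phi> 1 = 1" using ring_hom_one[OF \<phi>] by simp
  moreover have "\<phi> 0 = 0" using ring_hom_add[OF \<phi>, of 0 0] by simp
  ultimately have "f \<one> = u" "f s = v"
    using uv[of "Dual 1 0"] uv[of "Dual 0 1"] by (simp_all add: of_dual_simps)
  with uv show ?thesis by simp
qed

lemma (in dual_model) linear_forms_iso:
  fixes \<phi> :: "'k \<Rightarrow> 'a::comm_ring_1"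
  assumes \<phi>: "\<phi> \<in> ring_hom ring_of_type_algebra ring_of_type_algebra"
  shows "(\<lambda>f. (f \<one>, f s)) \<in> mod_iso ring_of_type_algebra
    (hom_module ring_of_type_algebra \<phi> (alg_module E i) (alg_module ring_of_type_algebra (\<lambda>a. a)))
    (module_dsum (alg_module ring_of_type_algebra (\<lambda>a. a)) (alg_module ring_of_type_algebra (\<lambda>a. a)))"
    (is "?F \<in> mod_iso _ ?H ?A")
proof -
  have "bij_betw ?F (carrier ?H) (carrier ?A)"
  proof (rule bij_betwI')
    fix f g assume f: "f \<in> carrier ?H" and g: "g \<in> carrier ?H"
    show "(?F f = ?F g) = (f = g)"
    proof
      assume "?F f = ?F g"
      then have "f (of_dual d) = g (of_dual d)" for d
        using linear_form_eq[OF \<phi> f, of d] linear_form_eq[OF \<phi> g, of d] by simp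
      then have "f x = g x" if "x \<in> carrier E" for x using that of_to_dual by metis
      with f g linear_form_iff[OF \<phi>] show "f = g" by (metis extensionalityI)
    qed simp
  next
    fix y assume "y \<in> carrier ?A"
    obtain u v where y: "y = (u, v)" by (cases y)
    define f where "f = (\<lambda>x\<in>carrier E. \<phi> (re (to_dual x)) * u + \<phi> (eps (to_dual x)) * v)"
    have fd: "f (of_dual d) = \<phi> (re d) * u + \<phi> (eps d) * v" for d
      by (simp add: f_def)
    then have f: "f \<in> carrier ?H"
      unfolding linear_form_iff[OF \<phi>] by (auto simp: f_def)
    have "\<phi> 1 = 1" using ring_hom_one[OF \<phi>] by simp
    moreover have "\<phi> 0 = 0" using ring_hom_add[OF \<phi>, of 0 0] by simp
    ultimately have "f \<one> = u" "f s = v"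
      using fd[of "Dual 1 0"] fd[of "Dual 0 1"] by (simp_all add: of_dual_simps)
    with f y show "\<exists>f\<in>carrier ?H. y = ?F f" by blast
  qed auto
  then show ?thesis
    by (simp add: mod_iso_def mod_hom_def hom_module_def)
qed

text \<open>The candidate is transport through \<open>dual\<close>. Linearity over K suffices for
  uniqueness, because the value at T already fixes a ring map on the image of \<open>K(T)\<close>,
  and the value at \<open>s\<close> then fixes the rest.\<close>

lemma dual_models_unique_hom:
  fixes i :: "'k::field ratfun \<Rightarrow> 'e" and i' :: "'k ratfun \<Rightarrow> 'e'"
  assumes M: "dual_model E i s" and N: "dual_model E' i' s'"
  defines "h \<equiv> \<lambda>x\<in>carrier E. dual_map.of_dual E' i' s' (dual_model.to_dual E i s x)"
  shows "{h \<in> alg_hom (const_field :: 'k ring) (\<lambda>k. i (rat_const k)) E (\<lambda>k. i' (rat_const k)) E'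
      \<inter> extensional (carrier E). h (i rat_T) = i' rat_T \<and> h s = s'} = {h}" (is "?S = _")
    and "h \<in> ring_iso E E'"
proof -
  interpret M: dual_model E i s by fact
  interpret N: dual_model E' i' s' by fact
  have "N.of_dual \<circ> M.to_dual \<in> ring_hom E E'"
    by (rule ring_hom_trans[OF M.to_dual_hom N.of_dual_hom])
  then have hom: "h \<in> ring_hom E E'"
    unfolding h_def using M.E.ring_hom_restrict[of "N.of_dual \<circ> M.to_dual" E'] by simp
  have "bij_betw h (carrier E) (carrier E')"
    by (rule bij_betwI[where g = "\<lambda>y. M.of_dual (N.to_dual y)"]) (auto simp: h_def)
  with hom show "h \<in> ring_iso E E'" by (simp add: ring_iso_def)
  have h: "h \<in> ?S"
    using hom by (auto simp: alg_hom_def) (simp_all add: h_def N.of_dual_simps)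
  moreover have "k = h" if k: "k \<in> ?S" for k
  proof (rule extensionalityI)
    have k_hom: "k \<in> ring_hom E E'" using k by (simp add: alg_hom_def)
    have "(k \<circ> i) F = (h \<circ> i) F" for F
      by (rule ratfun_hom_eq[OF N.E.is_cring ring_hom_trans[OF M.i_hom k_hom] ring_hom_trans[OF M.i_hom hom]])
        (use k h in \<open>auto simp: alg_hom_def\<close>)
    then have ki: "k (i F) = h (i F)" for F by simp
    fix x assume "x \<in> carrier E"
    then have x: "x = i (re (M.to_dual x)) \<oplus>\<^bsub>E\<^esub> i (eps (M.to_dual x)) \<otimes>\<^bsub>E\<^esub> s"
      using M.of_to_dual[of x] by (simp add: M.of_dual_def)
    show "k x = h x"
      using k h by (subst (1 2) x)
        (simp add: ring_hom_add[OF k_hom] ring_hom_add[OF hom] ring_hom_mult[OF k_hom]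
          ring_hom_mult[OF hom] ki)
  qed (use k in \<open>auto simp: h_def\<close>)
  ultimately show "?S = {h}" by blast
qed

section \<open>The dual numbers over \<open>K\<close> and over \<open>K(T)\<close>\<close>

definition poly_dual :: "'k::field poly \<Rightarrow> 'k dual" where
  "poly_dual q = Dual (coeff q 0) (coeff q 1)"

lemma poly_dual_ring_hom: "ring_hom_ring ring_of_type_algebra ring_of_type_algebra poly_dual"
  by (intro ring_hom_ringI2 ring_from_type_algebra ring_hom_memI)
    (auto simp: poly_dual_def dual_eq_iff coeff_mult)

text \<open>The description as a kernel yields both that this set is an ideal and that truncation to
  degree one factors through the quotient.\<close>

lemma dual_ideal_eq_kernel:
  "dual_ideal = a_kernel ring_of_type_algebra ring_of_type_algebra (poly_dual :: 'k::field poly \<Rightarrow> _)"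
proof -
  have sq: "[:0, 1:] ^ 2 = [:0, 0, 1 :: 'k:]" by (simp add: power2_eq_square)
  have "q \<in> dual_ideal \<longleftrightarrow> poly_dual q = 0" for q :: "'k poly"
  proof
    assume "poly_dual q = 0"
    moreover obtain a b r where q: "q = pCons a (pCons b r)" by (metis pCons_cases)
    ultimately have "q = r * [:0, 0, 1:]"
      by (auto simp: poly_dual_def zero_dual_def)
    then show "q \<in> dual_ideal"
      by (auto simp: dual_ideal_def cgenideal_def sq)
  qed (auto simp: dual_ideal_def cgenideal_def sq poly_dual_def zero_dual_def)
  then show ?thesis by (auto simp: a_kernel_def')
qed

lemma dual_alg_model: "dual_model dual_alg (dual_const :: 'k::field \<Rightarrow> _) dual_S"
proof -
  let ?P = "ring_of_type_algebra :: 'k poly ring" and ?I = "dual_ideal :: 'k poly set"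
  interpret D: ring_hom_ring ?P ring_of_type_algebra poly_dual by (rule poly_dual_ring_hom)
  interpret I: ideal ?I ?P unfolding dual_ideal_eq_kernel by (rule D.kernel_is_ideal)
  define \<pi> where "\<pi> = (+>\<^bsub>?P\<^esub>) ?I"
  have \<pi>: "\<pi> \<in> ring_hom ?P dual_alg" unfolding \<pi>_def dual_alg_def by (rule I.rcos_ring_hom)
  have \<pi>_simps: "\<pi> (a + b) = \<pi> a \<oplus>\<^bsub>dual_alg\<^esub> \<pi> b" "\<pi> (a * b) = \<pi> a \<otimes>\<^bsub>dual_alg\<^esub> \<pi> b"
    "\<pi> 1 = \<one>\<^bsub>dual_alg\<^esub>" "\<pi> a \<in> carrier dual_alg" for a b
    using ring_hom_add[OF \<pi>, of a b] ring_hom_mult[OF \<pi>, of a b] ring_hom_one[OF \<pi>]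
      ring_hom_closed[OF \<pi>, of a] by auto
  have \<pi>_0: "\<pi> a = \<zero>\<^bsub>dual_alg\<^esub>" if "a \<in> ?I" for a
    unfolding \<pi>_def dual_alg_def FactRing_def using I.a_rcos_const[of a] that by simp
  interpret A: cring "dual_alg :: 'k poly set ring"
    unfolding dual_alg_def by (intro I.quotient_is_cring type_ring_cring)
  have const: "dual_const = (\<lambda>k. \<pi> [:k:])" and S: "dual_S = \<pi> [:0, 1:]"
    by (simp_all add: \<pi>_def dual_const_def dual_S_def fun_eq_iff)
  have sq: "[:0, 1:] * [:0, 1 :: 'k:] \<in> ?I"
    by (simp add: dual_ideal_eq_kernel a_kernel_def' poly_dual_def zero_dual_def)
  interpret dual_map dual_alg "dual_const :: 'k \<Rightarrow> _" dual_S
  proof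
    show "dual_const \<in> ring_hom (ring_of_type_algebra :: 'k ring) dual_alg"
      unfolding const
      by (rule ring_hom_memI)
        (simp_all add: \<pi>_simps flip: one_pCons, simp_all flip: \<pi>_simps, simp add: mult.commute)
    show "dual_S \<otimes>\<^bsub>dual_alg\<^esub> dual_S = \<zero>\<^bsub>(dual_alg :: 'k poly set ring)\<^esub>"
      unfolding S \<pi>_simps(2)[symmetric] by (rule \<pi>_0) (rule sq)
  qed (simp add: S \<pi>_simps)
  show ?thesis
  proof (rule dual_modelI)
    \<comment> \<open>\<open>poly_dual\<close> is constant on each coset, so the image of a coset is
      a singleton and its element is the value of the induced map.\<close>
    let ?\<sigma> = "\<lambda>x :: 'k poly set. the_elem (poly_dual ` x)"
    have \<sigma>_\<pi>: "?\<sigma> (\<pi> q) = poly_dual q" for q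
      unfolding \<pi>_def dual_ideal_eq_kernel by (rule D.the_elem_simp) simp
    show "?\<sigma> \<in> ring_hom dual_alg ring_of_type_algebra"
      unfolding dual_alg_def dual_ideal_eq_kernel by (rule D.the_elem_hom)
    show "?\<sigma> (dual_const a) = Dual a 0" for a
      unfolding const \<sigma>_\<pi> by (simp add: poly_dual_def)
    show "?\<sigma> dual_S = Dual 0 1"
      unfolding S \<sigma>_\<pi> by (simp add: poly_dual_def)
  next
    fix x assume "x \<in> carrier (dual_alg :: 'k poly set ring)"
    then obtain q where x: "x = \<pi> q"
      by (auto simp: dual_alg_def FactRing_def A_RCOSETS_def' \<pi>_def)
    obtain a b r where q: "q = pCons a (pCons b r)" by (metis pCons_cases)
    have "q = [:a:] + [:b:] * [:0, 1:] + r * ([:0, 1:] * [:0, 1:])" by (simp add: q)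
    then have "\<pi> q = \<pi> [:a:] \<oplus>\<^bsub>dual_alg\<^esub> \<pi> [:b:] \<otimes>\<^bsub>dual_alg\<^esub> dual_S \<oplus>\<^bsub>dual_alg\<^esub>
        \<pi> r \<otimes>\<^bsub>dual_alg\<^esub> (dual_S \<otimes>\<^bsub>dual_alg\<^esub> dual_S)"
      unfolding S by (simp only: \<pi>_simps)
    then have "x = of_dual (Dual a b)"
      unfolding of_dual_def by (simp add: x s_square const \<pi>_simps)
    then show "\<exists>d. x = of_dual d" ..
  qed
qed

lemma rat_dual_tensor_product:
  "tensor_product const_field ratfun_field dual_alg rat_const (dual_const :: 'k::field \<Rightarrow> _)"
proof -
  interpret D: dual_model dual_alg "dual_const :: 'k \<Rightarrow> _" dual_S by (rule dual_alg_model)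
  show ?thesis
    by (intro tensor_product.intro tensor_product_axioms.intro type_ring_cring D.E.is_cring) auto
qed

text \<open>This is base change of \<open>dual_alg_model\<close> from K to \<open>K(T)\<close>. The
  left inverse combines F on the left with the coordinates on the right, moved to
  \<open>K(T)\<close> by \<open>rat_const\<close>. For spanning, the coefficients in K of the right
  factor are carried across the tensor sign.\<close>

lemma rat_dual_model: "dual_model rat_dual (rd_struct :: 'k::field ratfun \<Rightarrow> _) rd_S"
proof -
  interpret D: dual_model dual_alg "dual_const :: 'k \<Rightarrow> _" dual_S by (rule dual_alg_model)
  interpret T: tensor_product const_field ratfun_field dual_alg rat_const "dual_const :: 'k \<Rightarrow> _"
    by (rule rat_dual_tensor_product)
  have TA: "T.TA = rat_dual" by (simp add: rat_dual_def)
  interpret R: cring "rat_dual :: ('k ratfun, 'k poly set) tensor ring"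
    using T.T.is_cring by (simp add: TA)
  interpret dual_map rat_dual "rd_struct :: 'k ratfun \<Rightarrow> _" rd_S
  proof
    show "rd_struct \<in> ring_hom (ratfun_field :: 'k ratfun ring) rat_dual"
      using T.inclusion_left by (simp add: TA rd_struct_def[abs_def] rd_tensor_def)
    show "rd_S \<in> carrier (rat_dual :: ('k ratfun, 'k poly set) tensor ring)"
      using T.pt_closed[of 1 dual_S] by (simp add: TA rd_S_def rd_tensor_def)
    show "rd_S \<otimes>\<^bsub>rat_dual\<^esub> rd_S = \<zero>\<^bsub>(rat_dual :: ('k ratfun, 'k poly set) tensor ring)\<^esub>"
      using T.pt_mult[of 1 dual_S 1 dual_S] T.pt_add_right[of 1 "\<zero>\<^bsub>dual_alg\<^esub>" "\<zero>\<^bsub>dual_alg\<^esub>"]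
        T.pt_closed[of 1 "\<zero>\<^bsub>dual_alg\<^esub>"]
      by (simp add: TA rd_S_def rd_tensor_def D.s_square R.add.r_cancel_one')
  qed
  let ?u = "\<lambda>F :: 'k ratfun. Dual F 0"
  let ?c = "\<lambda>d. Dual (rat_const (re d)) (rat_const (eps d))"
  let ?v = "?c \<circ> D.to_dual"
  have u: "?u \<in> ring_hom ratfun_field ring_of_type_algebra"
    and c: "?c \<in> ring_hom ring_of_type_algebra ring_of_type_algebra"
    by (rule ring_hom_memI; auto simp: dual_eq_iff)+
  have v: "?v \<in> ring_hom dual_alg ring_of_type_algebra"
    by (rule ring_hom_trans[OF D.to_dual_hom c])
  obtain \<sigma> where \<sigma>: "\<sigma> \<in> ring_hom T.TA ring_of_type_algebra"
    and \<sigma>_pt: "\<And>F l. F \<in> carrier ratfun_field \<Longrightarrow> l \<in> carrier dual_alg \<Longrightarrow>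
      \<sigma> (T.pt F l) = ?u F \<otimes>\<^bsub>ring_of_type_algebra\<^esub> ?v l"
    using T.tensor_universal[OF type_ring_cring u v] by auto
  show ?thesis
  proof (rule dual_modelI)
    show "\<sigma> \<in> ring_hom rat_dual ring_of_type_algebra" using \<sigma> by (simp add: TA)
    show "\<sigma> (rd_struct F) = Dual F 0" for F
    proof -
      have "D.to_dual \<one>\<^bsub>dual_alg\<^esub> = Dual 1 0" using D.to_dual_simps(1)[of 1] by simp
      then show ?thesis using \<sigma>_pt[of F "\<one>\<^bsub>dual_alg\<^esub>"]
        by (simp add: rd_struct_def rd_tensor_def dual_eq_iff)
    qed
    show "\<sigma> rd_S = Dual 0 1"
      using \<sigma>_pt[of 1 dual_S] by (simp add: rd_S_def rd_tensor_def dual_eq_iff)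
  next
    fix x assume "x \<in> carrier (rat_dual :: ('k ratfun, 'k poly set) tensor ring)"
    then have "x \<in> carrier T.TA" by (simp add: TA)
    then show "\<exists>d. x = of_dual d"
    proof (induction x rule: T.tensor_induct)
      case (pure F l)
      define a where "a = re (D.to_dual l)"
      define b where "b = eps (D.to_dual l)"
      have l: "l = dual_const a \<oplus>\<^bsub>dual_alg\<^esub> dual_const b \<otimes>\<^bsub>dual_alg\<^esub> dual_S"
        using D.of_to_dual[of l] pure by (simp add: D.of_dual_def a_def b_def)
      have "T.pt F l = T.pt F (dual_const a \<otimes>\<^bsub>dual_alg\<^esub> \<one>\<^bsub>dual_alg\<^esub>) \<oplus>\<^bsub>rat_dual\<^esub> T.pt F (dual_const b \<otimes>\<^bsub>dual_alg\<^esub> dual_S)"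
        unfolding l by (simp add: T.pt_add_right TA)
      also have "\<dots> = T.pt (F * rat_const a) \<one>\<^bsub>dual_alg\<^esub> \<oplus>\<^bsub>rat_dual\<^esub> T.pt (F * rat_const b) dual_S"
        using T.pt_balanced[of a F "\<one>\<^bsub>dual_alg\<^esub>"] T.pt_balanced[of b F dual_S] by simp
      also have "\<dots> = of_dual (Dual (F * rat_const a) (F * rat_const b))"
        unfolding of_dual_def using T.pt_decompose[of "F * rat_const b" dual_S]
        by (simp add: rd_struct_def rd_S_def rd_tensor_def TA)
      finally show ?case by blast
    next
      case (add x y)
      then obtain d e where "x = of_dual d" "y = of_dual e" by blast
      then show ?case
        using ring_hom_add[OF of_dual_hom, of d e] by (auto simp: TA)
    qed
  qed
qed

text \<open>Coordinates for the inclusion of the right factor, needed to restrict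
  \<open>K(T)\<close>-linear forms on \<open>rat_dual\<close> to K-linear forms on
  \<open>dual_alg\<close>.\<close>

lemma rd_tensor_1_eq:
  assumes "l = dual_map.of_dual dual_alg dual_const dual_S d"
  shows "rd_tensor 1 l =
    dual_map.of_dual rat_dual rd_struct rd_S (Dual (rat_const (re d)) (rat_const (eps d :: 'k::field)))"
proof -
  interpret D: dual_model dual_alg "dual_const :: 'k \<Rightarrow> _" dual_S by (rule dual_alg_model)
  interpret R: dual_model rat_dual "rd_struct :: 'k ratfun \<Rightarrow> _" rd_S by (rule rat_dual_model)
  interpret T: tensor_product const_field ratfun_field dual_alg rat_const "dual_const :: 'k \<Rightarrow> _"
    by (rule rat_dual_tensor_product)
  have "T.pt 1 l = T.pt 1 (dual_const (re d) \<otimes>\<^bsub>dual_alg\<^esub> \<one>\<^bsub>dual_alg\<^esub>) \<oplus>\<^bsub>rat_dual\<^esub>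
      T.pt 1 (dual_const (eps d) \<otimes>\<^bsub>dual_alg\<^esub> dual_S)"
    unfolding assms D.of_dual_def by (simp add: T.pt_add_right rat_dual_def)
  also have "\<dots> = T.pt (rat_const (re d)) \<one>\<^bsub>dual_alg\<^esub> \<oplus>\<^bsub>rat_dual\<^esub> T.pt (rat_const (eps d)) dual_S"
    using T.pt_balanced[of "re d" 1 "\<one>\<^bsub>dual_alg\<^esub>"] T.pt_balanced[of "eps d" 1 dual_S] by simp
  finally show ?thesis
    unfolding R.of_dual_def using T.pt_decompose[of "rat_const (eps d)" dual_S]
    by (simp add: rd_struct_def rd_S_def rd_tensor_def rat_dual_def)
qed

text \<open>The Taylor expansion is a K-algebra map with the prescribed value at T, and by
  \<open>ratfun_hom_eq\<close> there is no other, so the description in \<open>rat_subst\<close>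
  denotes it. The cases c = 1 and c = -1 are used.\<close>

lemma rat_subst_eq:
  fixes c :: "'k::field ratfun"
  shows "rat_subst (dual_map.of_dual rat_dual rd_struct rd_S (Dual rat_T c)) F =
    dual_map.of_dual rat_dual rd_struct rd_S (taylor c F)"
proof -
  interpret R: dual_model rat_dual "rd_struct :: 'k ratfun \<Rightarrow> _" rd_S by (rule rat_dual_model)
  let ?h = "R.of_dual \<circ> taylor c"
  have hom: "?h \<in> ring_hom ratfun_field rat_dual"
    by (rule ring_hom_trans[OF taylor_hom R.of_dual_hom])
  have const: "?h (rat_const k) = rd_const k" for k
    by (simp add: taylor_def R.of_dual_simps rd_const_def)
  have "rat_subst (R.of_dual (Dual rat_T c)) = ?h"
    unfolding rat_subst_def
  proof (rule the_equality)
    show "?h \<in> alg_hom const_field rat_const ratfun_field rd_const rat_dual \<and>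
        ?h rat_T = R.of_dual (Dual rat_T c)"
      using hom const by (simp add: alg_hom_def taylor_def)
  next
    fix k assume k: "k \<in> alg_hom const_field rat_const ratfun_field rd_const rat_dual \<and>
        k rat_T = R.of_dual (Dual rat_T c)"
    show "k = ?h"
    proof
      fix F
      show "k F = ?h F"
        by (rule ratfun_hom_eq[OF R.E.is_cring _ hom])
          (use k const in \<open>auto simp: alg_hom_def taylor_def\<close>)
    qed
  qed
  then show ?thesis by simp
qed

section \<open>The algebra \<open>Q\<close> of \<open>K(T)/K(T\<^sup>p)\<close>\<close>

lemma to_fract_power: "to_fract (q ^ n) = to_fract q ^ n"
  by (induction n) simp_all

text \<open>Since \<open>a \<otimes> a\<close> becomes \<open>a\<^sup>2\<close> in \<open>Q\<close>, the two hypotheses hold for \<open>x = T \<otimes> 1 \<otimes> 1\<close>, \<open>y = 1 \<otimes> T \<otimes> 1\<close> and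
  \<open>t = 1 \<otimes> 1 \<otimes> T\<close>: take \<open>a = T\<close> and \<open>a = 1 + T\<close>.\<close>
lemma (in cring) elementary_symmetric_eq:
  assumes closed: "x \<in> carrier R" "y \<in> carrier R" "t \<in> carrier R"
    and prod: "x \<otimes> y = t \<otimes> t" and shift: "(\<one> \<oplus> x) \<otimes> (\<one> \<oplus> y) = (\<one> \<oplus> t) \<otimes> (\<one> \<oplus> t)"
  shows "x \<oplus> y = t \<oplus> t" "(x \<ominus> t) \<otimes> (x \<ominus> t) = \<zero>" "y = t \<ominus> (x \<ominus> t)" "x = t \<oplus> (x \<ominus> t)"
proof -
  have "x \<oplus> y = (\<one> \<oplus> x) \<otimes> (\<one> \<oplus> y) \<ominus> \<one> \<ominus> x \<otimes> y"
    using closed by algebra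
  also have "\<dots> = t \<oplus> t"
    unfolding shift prod using closed by algebra
  finally show sum: "x \<oplus> y = t \<oplus> t" .
  \<comment> \<open>Expanding the square and rearranging makes both known relations visible: the
    first two terms cancel by \<open>prod\<close>, the last bracket by \<open>sum\<close>.\<close>
  have "(x \<ominus> t) \<otimes> (x \<ominus> t) = t \<otimes> t \<ominus> x \<otimes> y \<ominus> x \<otimes> ((t \<oplus> t) \<ominus> (x \<oplus> y))"
    using closed by algebra
  also have "\<dots> = \<zero>" unfolding sum prod using closed by algebra
  finally show "(x \<ominus> t) \<otimes> (x \<ominus> t) = \<zero>" .
  have "y = (x \<oplus> y) \<ominus> x" using closed by algebra
  also have "\<dots> = t \<ominus> (x \<ominus> t)" unfolding sum using closed by algebra
  finally show "y = t \<ominus> (x \<ominus> t)" .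
  show "x = t \<oplus> (x \<ominus> t)" using closed by algebra
qed

locale frobenius_extension =
  fixes p :: nat and base :: "'k::field ratfun ring"
  defines "base \<equiv> frob_subfield p"
  assumes char: "CHAR('k) = p" and p_pos: "p > 0"
begin

lemma base_carrier: "carrier base = generate_field ratfun_field (range rat_const \<union> {rat_T ^ p})"
  by (simp add: base_def frob_subfield_def)

lemma rat_const_base [simp]: "rat_const k \<in> carrier base"
  unfolding base_carrier by (intro generate_field.incl) simp

lemma rat_T_pow_base [simp]: "rat_T ^ p \<in> carrier base"
  unfolding base_carrier by (intro generate_field.incl) simp

lemma base_closed:
  assumes "F \<in> carrier base" "G \<in> carrier base"
  shows "F + G \<in> carrier base" "F * G \<in> carrier base"
  using generate_field.eng_add[of F ratfun_field _ G] generate_field.eng_mult[of F ratfun_field _ G] assms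
  by (auto simp: base_carrier)

lemma base_inverse: "F \<in> carrier base \<Longrightarrow> F \<noteq> 0 \<Longrightarrow> inverse F \<in> carrier base"
  using generate_field.m_inv[of F ratfun_field] by (auto simp: base_carrier)

text \<open>The elements killed by a derivation form a field, so only the generators count, and the
  derivative of T^p is p T^(p-1), which is zero in characteristic p.\<close>

lemma rat_deriv_base: "F \<in> carrier base \<Longrightarrow> rat_deriv F = 0"
  unfolding base_carrier
proof (induction rule: generate_field.induct)
  case (incl F)
  have "rat_deriv (rat_T ^ p) = (0 :: 'k ratfun)"
  proof -
    have "of_nat p = (0 :: 'k)" using char by (metis of_nat_CHAR)
    then have "pderiv ([:0, 1 :: 'k:] ^ p) = 0" by (simp add: pderiv_power)
    then show ?thesis
      by (simp add: rat_T_def rat_deriv_to_fract flip: to_fract_power)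
  qed
  with incl show ?case by auto
next
  case (m_inv F)
  then have "F \<noteq> 0" by simp
  then have "F * rat_deriv (inverse F) = 0"
    using rat_deriv_mult[of F "inverse F"] m_inv by simp
  with \<open>F \<noteq> 0\<close> show ?case by simp
qed (simp_all add: rat_deriv_add rat_deriv_mult rat_deriv_uminus)

section \<open>The tensor square, its diagonal subalgebra and Q\<close>

sublocale S: tensor_product base ratfun_field ratfun_field "\<lambda>x. x" "\<lambda>x. x"
  by (intro tensor_product.intro tensor_product_axioms.intro type_ring_cring) auto

abbreviation "\<mu> \<equiv> mult_map base (\<lambda>x. x) ratfun_field"

lemma mult_map_hom: "\<mu> \<in> ring_hom S.TA ratfun_field"
  and mult_map_pt [simp]: "\<mu> (S.pt a b) = a * b"
proof -
  have id: "(\<lambda>a. a) \<in> ring_hom (ratfun_field :: 'k ratfun ring) ratfun_field"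
    by (rule ring_hom_memI) auto
  show "\<mu> \<in> ring_hom S.TA ratfun_field" "\<mu> (S.pt a b) = a * b"
    unfolding mult_map_def using S.tensor_copair[OF type_ring_cring id id] by auto
qed

abbreviation "\<Delta> \<equiv> diag_alg base (\<lambda>x. x) ratfun_field"

lemma diag_carrier:
  "carrier \<Delta> = generate_ring S.TA ({S.pt r 1 | r. r \<in> carrier base} \<union> {S.pt a a | a. True})"
  by (simp add: diag_alg_def square_tensor_def tensor_square_def)

lemma diag_subset: "carrier \<Delta> \<subseteq> carrier S.TA"
  unfolding diag_carrier by (rule S.T.generate_ring_incl) auto

sublocale Q: tensor_product \<Delta> S.TA ratfun_field "\<lambda>x. x" \<mu>
  by (intro tensor_product.intro tensor_product_axioms.intro type_ring_cring S.T.is_cring)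
    (use diag_subset in auto)

lemma Q_TA: "Q.TA = QT_alg p"
  by (simp add: Q_alg_def tensor_square_def base_def)

lemma QT_tensor_eq: "QT_tensor p a b c = Q.pt (S.pt a b) c"
  by (simp add: Q_tensor_def tensor_square_def square_tensor_def base_def)

definition \<iota> :: "'k ratfun \<Rightarrow> (('k ratfun, 'k ratfun) tensor, 'k ratfun) tensor" where
  "\<iota> F = QT_tensor p 1 1 F"

definition left :: "'k ratfun \<Rightarrow> (('k ratfun, 'k ratfun) tensor, 'k ratfun) tensor" where
  "left F = QT_tensor p F 1 1"

definition right :: "'k ratfun \<Rightarrow> (('k ratfun, 'k ratfun) tensor, 'k ratfun) tensor" where
  "right F = QT_tensor p 1 F 1"

text \<open>The image of S under the map from \<open>rat_dual\<close> to Q.\<close>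

definition w :: "(('k ratfun, 'k ratfun) tensor, 'k ratfun) tensor" where
  "w = left rat_T \<ominus>\<^bsub>QT_alg p\<^esub> \<iota> rat_T"

lemma S_one: "S.pt 1 1 = \<one>\<^bsub>S.TA\<^esub>"
  using S.pt_one by simp

lemma \<iota>_hom: "\<iota> \<in> ring_hom ratfun_field Q.TA"
  using Q.inclusion_right by (simp add: \<iota>_def[abs_def] QT_tensor_eq S_one)

lemma left_hom: "left \<in> ring_hom ratfun_field Q.TA"
  using ring_hom_trans[OF S.inclusion_left Q.inclusion_left]
  by (simp add: left_def[abs_def] QT_tensor_eq comp_def)

lemma right_hom: "right \<in> ring_hom ratfun_field Q.TA"
  using ring_hom_trans[OF S.inclusion_right Q.inclusion_left]
  by (simp add: right_def[abs_def] QT_tensor_eq comp_def)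

text \<open>Balancing over \<open>\<Delta>\<close> moves an element of \<open>\<Delta>\<close> into
  the third factor, where it acts through \<open>\<mu>\<close>. Applied to r \<otimes> 1 and a
  \<otimes> a, this gives \<open>left_const\<close> and \<open>left_mult_right\<close>.\<close>

lemma diag_eq: "\<delta> \<in> carrier \<Delta> \<Longrightarrow> Q.pt \<delta> 1 = \<iota> (\<mu> \<delta>)"
  using Q.pt_balanced[of \<delta> "\<one>\<^bsub>S.TA\<^esub>" 1] diag_subset
  by (auto simp: \<iota>_def QT_tensor_eq S_one)

lemma left_const: "left (rat_const k) = \<iota> (rat_const k)"
proof -
  have "S.pt (rat_const k) 1 \<in> carrier \<Delta>"
    unfolding diag_carrier by (intro generate_ring.incl UnI1) auto
  from diag_eq[OF this] show ?thesis by (simp add: left_def QT_tensor_eq)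
qed

lemma right_const: "right (rat_const k) = \<iota> (rat_const k)"
  using S.pt_balanced[of "rat_const k" 1 1] left_const[of k]
  by (simp add: left_def right_def QT_tensor_eq)

lemma left_mult_right: "left F \<otimes>\<^bsub>Q.TA\<^esub> right F = \<iota> (F * F)"
proof -
  have "S.pt F F \<in> carrier \<Delta>"
    unfolding diag_carrier by (intro generate_ring.incl UnI2) auto
  from diag_eq[OF this] have "Q.pt (S.pt F F) 1 = \<iota> (F * F)" by simp
  then show ?thesis
    by (simp add: left_def right_def QT_tensor_eq Q.pt_mult S.pt_mult)
qed

lemma closed [simp]: "left F \<in> carrier Q.TA" "right F \<in> carrier Q.TA" "\<iota> F \<in> carrier Q.TA"
  using ring_hom_closed[OF left_hom, of F] ring_hom_closed[OF right_hom, of F]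
    ring_hom_closed[OF \<iota>_hom, of F] by auto

lemma w_square: "w \<otimes>\<^bsub>Q.TA\<^esub> w = \<zero>\<^bsub>Q.TA\<^esub>"
  and right_T: "right rat_T = \<iota> rat_T \<ominus>\<^bsub>Q.TA\<^esub> w"
  and left_T: "left rat_T = \<iota> rat_T \<oplus>\<^bsub>Q.TA\<^esub> w"
proof -
  have one: "h (1 + F) = \<one>\<^bsub>Q.TA\<^esub> \<oplus>\<^bsub>Q.TA\<^esub> h F" if "h \<in> ring_hom ratfun_field Q.TA" for h F
    using ring_hom_add[OF that, of 1 F] ring_hom_one[OF that] by simp
  have prod: "left F \<otimes>\<^bsub>Q.TA\<^esub> right F = \<iota> F \<otimes>\<^bsub>Q.TA\<^esub> \<iota> F" for F
    using left_mult_right[of F] ring_hom_mult[OF \<iota>_hom, of F F] by simp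
  have shift: "(\<one>\<^bsub>Q.TA\<^esub> \<oplus>\<^bsub>Q.TA\<^esub> left rat_T) \<otimes>\<^bsub>Q.TA\<^esub> (\<one>\<^bsub>Q.TA\<^esub> \<oplus>\<^bsub>Q.TA\<^esub> right rat_T) =
      (\<one>\<^bsub>Q.TA\<^esub> \<oplus>\<^bsub>Q.TA\<^esub> \<iota> rat_T) \<otimes>\<^bsub>Q.TA\<^esub> (\<one>\<^bsub>Q.TA\<^esub> \<oplus>\<^bsub>Q.TA\<^esub> \<iota> rat_T)"
    using prod[of "1 + rat_T"] by (simp only: one[OF left_hom] one[OF right_hom] one[OF \<iota>_hom])
  note eqs = Q.T.elementary_symmetric_eq[OF closed(1,2,3) prod shift]
  show "w \<otimes>\<^bsub>Q.TA\<^esub> w = \<zero>\<^bsub>Q.TA\<^esub>" "right rat_T = \<iota> rat_T \<ominus>\<^bsub>Q.TA\<^esub> w"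
    "left rat_T = \<iota> rat_T \<oplus>\<^bsub>Q.TA\<^esub> w"
    unfolding w_def Q_TA[symmetric] by (fact eqs(2,3,4))+
qed

sublocale QM: dual_map Q.TA \<iota> w
proof
  show "\<iota> \<in> ring_hom ratfun_field Q.TA" by (rule \<iota>_hom)
  show "w \<in> carrier Q.TA" by (simp add: w_def flip: Q_TA)
qed (rule w_square)

lemma left_eq: "left F = QM.of_dual (taylor 1 F)"
proof -
  have "left F = (QM.of_dual \<circ> taylor 1) F"
    by (rule ratfun_hom_eq[OF Q.T.is_cring left_hom ring_hom_trans[OF taylor_hom QM.of_dual_hom]])
      (simp_all add: taylor_def QM.of_dual_simps left_const left_T, simp_all add: QM.of_dual_def)
  then show ?thesis by simp
qed

lemma right_eq: "right F = QM.of_dual (taylor (- 1) F)"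
proof -
  have "\<iota> (- 1) = \<ominus>\<^bsub>Q.TA\<^esub> \<one>\<^bsub>Q.TA\<^esub>"
    using QM.i_simps(4)[of "- 1" 1] QM.i_simps(2,3) by (simp add: Q.T.minus_equality)
  then have T: "QM.of_dual (Dual rat_T (- 1)) = right rat_T"
    by (simp add: right_T QM.of_dual_def Q.T.l_minus Q.T.minus_eq)
  have "right F = (QM.of_dual \<circ> taylor (- 1)) F"
    by (rule ratfun_hom_eq[OF Q.T.is_cring right_hom ring_hom_trans[OF taylor_hom QM.of_dual_hom]])
      (simp_all add: taylor_def QM.of_dual_simps right_const T)
  then show ?thesis by simp
qed

text \<open>This is the compatibility over \<open>\<Delta>\<close> that the universal property of Q
  asks for. Both sides are ring maps in \<open>\<delta>\<close>, so they agree on a subring, and it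
  is enough to test the generators of \<open>\<Delta>\<close>.\<close>

lemma diag_scalar:
  assumes h: "h \<in> ring_hom S.TA ring_of_type_algebra"
    and pt: "\<And>a b. h (S.pt a b) = taylor 1 a * taylor (- 1) b" and \<delta>: "\<delta> \<in> carrier \<Delta>"
  shows "h \<delta> = Dual (\<mu> \<delta>) 0"
proof -
  have scalars: "subring {z \<in> carrier S.TA. h z = Dual (\<mu> z) 0} S.TA" (is "subring ?H _")
  proof -
    interpret h: ring_hom_cring S.TA "ring_of_type_algebra :: 'k ratfun dual ring" h
      by (intro ring_hom_cring.intro ring_hom_cring_axioms.intro type_ring_cring S.T.is_cring h)
    interpret m: ring_hom_cring S.TA "ratfun_field :: 'k ratfun ring" \<mu>
      by (intro ring_hom_cring.intro ring_hom_cring_axioms.intro type_ring_cring S.T.is_cring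
          mult_map_hom)
    show ?thesis
      by (rule S.T.subringI) (auto simp: dual_eq_iff)
  qed
  have "carrier \<Delta> \<subseteq> ?H"
    unfolding diag_carrier
  proof (rule S.T.generate_ring_min_subring1[OF _ scalars])
    show "{S.pt r 1 |r. r \<in> carrier base} \<union> {S.pt a a |a. True} \<subseteq> ?H"
      by (auto simp: pt taylor_def dual_eq_iff rat_deriv_base)
  qed auto
  with \<delta> show ?thesis by blast
qed

text \<open>The left inverse is built in two stages, over \<open>base\<close> on the tensor square
  and over \<open>\<Delta>\<close> on Q. For spanning, a pure tensor is a product of values of
  \<open>left\<close>, \<open>right\<close> and \<open>\<iota>\<close>, all in the range of the ring
  map \<open>of_dual\<close>.\<close>

sublocale QM: dual_model Q.TA \<iota> w
proof -
  have compat: "taylor 1 r = taylor (- 1) r" if "r \<in> carrier base" for r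
    using rat_deriv_base[OF that] by (simp add: taylor_def)
  obtain h where h: "h \<in> ring_hom S.TA ring_of_type_algebra"
    and h_pt: "\<And>a b. h (S.pt a b) = taylor 1 a * taylor (- 1) b"
    using S.tensor_universal[OF type_ring_cring taylor_hom taylor_hom compat] by auto
  have const: "(\<lambda>F. Dual F 0) \<in> ring_hom (ratfun_field :: 'k ratfun ring) ring_of_type_algebra"
    by (rule ring_hom_memI) (auto simp: dual_eq_iff)
  obtain \<sigma> where \<sigma>: "\<sigma> \<in> ring_hom Q.TA ring_of_type_algebra"
    and \<sigma>_pt: "\<And>z c. z \<in> carrier S.TA \<Longrightarrow> \<sigma> (Q.pt z c) = h z * Dual c 0"
    using Q.tensor_universal[OF type_ring_cring h const diag_scalar[OF h h_pt]] by auto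
  have \<sigma>_QT: "\<sigma> (QT_tensor p a b c) = taylor 1 a * taylor (- 1) b * Dual c 0" for a b c
    by (simp add: QT_tensor_eq \<sigma>_pt h_pt)
  show "dual_model Q.TA \<iota> w"
  proof (rule QM.dual_modelI[OF \<sigma>])
    show \<iota>: "\<sigma> (\<iota> F) = Dual F 0" for F
      unfolding \<iota>_def \<sigma>_QT by (simp add: taylor_def dual_eq_iff)
    have "\<sigma> (left rat_T) = \<sigma> (\<iota> rat_T) + \<sigma> w"
      unfolding left_T using ring_hom_add[OF \<sigma>, of "\<iota> rat_T" w] by simp
    moreover have "\<sigma> (left rat_T) = Dual rat_T 1"
      unfolding left_def \<sigma>_QT by (simp add: taylor_def dual_eq_iff)
    ultimately show "\<sigma> w = Dual 0 1" by (simp add: \<iota> dual_eq_iff)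
  next
    fix x assume "x \<in> carrier Q.TA"
    then show "\<exists>d. x = QM.of_dual d"
    proof (induction x rule: Q.tensor_induct)
      case (pure z c)
      from pure(1) show ?case
      proof (induction z rule: S.tensor_induct)
        case (pure a b)
        have "Q.pt (S.pt a b) c = left a \<otimes>\<^bsub>Q.TA\<^esub> right b \<otimes>\<^bsub>Q.TA\<^esub> \<iota> c"
          by (simp add: left_def right_def \<iota>_def QT_tensor_eq Q.pt_mult S.pt_mult)
        also have "\<dots> = QM.of_dual (taylor 1 a * taylor (- 1) b * Dual c 0)"
          unfolding left_eq right_eq QM.of_dual_simps(1)[of c, symmetric]
          using ring_hom_mult[OF QM.of_dual_hom] by simp
        finally show ?case by blast
      next
        case (add x y)
        then obtain d e where "Q.pt x c = QM.of_dual d" "Q.pt y c = QM.of_dual e" by blast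
        then show ?case
          using ring_hom_add[OF QM.of_dual_hom, of d e] add by (auto simp: Q.pt_add_left)
      qed
    next
      case (add x y)
      then obtain d e where "x = QM.of_dual d" "y = QM.of_dual e" by blast
      then show ?case
        using ring_hom_add[OF QM.of_dual_hom, of d e] by auto
    qed
  qed
qed

text \<open>The augmentation is the identity on scalars and kills \<open>w\<close>, so in
  coordinates it is \<open>re\<close>; its kernel is the line spanned by \<open>w\<close>.\<close>

lemma WT_iso: "mod_iso (ratfun_field :: 'k ratfun ring) (WT_module p) ratfun_module \<noteq> {}"
proof -
  have id: "(\<lambda>a. a) \<in> ring_hom (ratfun_field :: 'k ratfun ring) ratfun_field"
    by (rule ring_hom_memI) auto
  define aug where "aug = Q_aug base (\<lambda>x. x) ratfun_field"
  have aug: "aug \<in> ring_hom Q.TA ratfun_field" and aug_pt: "aug (QT_tensor p a b c) = a * b * c" for a b c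
    using Q.tensor_copair[OF type_ring_cring mult_map_hom id]
    by (auto simp: aug_def Q_aug_def QT_tensor_eq tensor_square_def)
  have aug_\<iota>: "aug (\<iota> F) = F" for F by (simp add: \<iota>_def aug_pt)
  have "aug (left rat_T) = rat_T" by (simp add: left_def aug_pt)
  then have aug_w: "aug w = 0"
    unfolding left_T using ring_hom_add[OF aug, of "\<iota> rat_T" w] by (simp add: aug_\<iota>)
  have aug_of_dual: "aug (QM.of_dual d) = re d" for d
    unfolding QM.of_dual_def
    using ring_hom_add[OF aug, of "\<iota> (re d)" "\<iota> (eps d) \<otimes>\<^bsub>Q.TA\<^esub> w"]
      ring_hom_mult[OF aug, of "\<iota> (eps d)" w]
    by (simp add: aug_\<iota> aug_w)
  have W: "carrier (WT_module p) = {x \<in> carrier Q.TA. aug x = 0}"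
    unfolding W_module_def Q_TA[symmetric] by (simp add: a_kernel_def' aug_def base_def)
  have W_iff: "x \<in> carrier (WT_module p) \<longleftrightarrow> (\<exists>b. x = QM.of_dual (Dual 0 b))" for x
  proof
    assume "x \<in> carrier (WT_module p)"
    then have "x \<in> carrier Q.TA" "re (QM.to_dual x) = 0"
      using aug_of_dual[of "QM.to_dual x"] by (auto simp: W)
    then show "\<exists>b. x = QM.of_dual (Dual 0 b)"
      using QM.of_to_dual by (metis dual.collapse)
  qed (auto simp: W aug_of_dual)
  have W_add: "x \<oplus>\<^bsub>WT_module p\<^esub> y = x \<oplus>\<^bsub>Q.TA\<^esub> y"
    and W_smult: "a \<odot>\<^bsub>WT_module p\<^esub> x = \<iota> a \<otimes>\<^bsub>Q.TA\<^esub> x" for a x y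
    by (simp_all add: W_module_def Q_TA alg_module_def \<iota>_def Q_struct_def)
  let ?h = "\<lambda>x. eps (QM.to_dual x)"
  have "?h \<in> mod_iso (ratfun_field :: 'k ratfun ring) (WT_module p) ratfun_module"
    unfolding mod_iso_def mod_hom_def
  proof (intro CollectI conjI ballI)
    show "?h (x \<oplus>\<^bsub>WT_module p\<^esub> y) = ?h x \<oplus>\<^bsub>ratfun_module\<^esub> ?h y"
      if "x \<in> carrier (WT_module p)" "y \<in> carrier (WT_module p)" for x y
      using that ring_hom_add[OF QM.to_dual_hom, of x y] by (simp add: W_add W)
    show "?h (a \<odot>\<^bsub>WT_module p\<^esub> x) = a \<odot>\<^bsub>ratfun_module\<^esub> ?h x"
      if "x \<in> carrier (WT_module p)" for a x
      using that ring_hom_mult[OF QM.to_dual_hom, of "\<iota> a" x] by (simp add: W_smult W)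
    show "bij_betw ?h (carrier (WT_module p)) (carrier ratfun_module)"
      by (rule bij_betwI[where g = "\<lambda>b. QM.of_dual (Dual 0 b)"]) (auto simp: W_iff)
  qed auto
  then show ?thesis by blast
qed

lemma isomorphisms:
  "\<exists>\<alpha> \<beta>.
      {h \<in> alg_hom (const_field :: 'k ring) (QT_const p) (QT_alg p) rd_const rat_dual
             \<inter> extensional (carrier (QT_alg p)).
          h (QT_tensor p rat_T 1 1) = rd_T \<oplus>\<^bsub>rat_dual\<^esub> rd_S \<and>
          h (QT_tensor p 1 rat_T 1) = rd_T \<ominus>\<^bsub>rat_dual\<^esub> rd_S \<and>
          h (QT_tensor p 1 1 rat_T) = rd_T} = {\<alpha>} \<and>
      {h \<in> alg_hom (const_field :: 'k ring) rd_const rat_dual (QT_const p) (QT_alg p)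
             \<inter> extensional (carrier rat_dual).
          h rd_T = QT_tensor p 1 1 rat_T \<and>
          h rd_S = QT_tensor p rat_T 1 1 \<ominus>\<^bsub>QT_alg p\<^esub> QT_tensor p 1 1 rat_T} = {\<beta>} \<and>
      \<alpha> \<in> ring_iso (QT_alg p) rat_dual \<and>
      \<beta> \<in> ring_iso rat_dual (QT_alg p) \<and>
      (\<forall>x\<in>carrier (QT_alg p). \<beta> (\<alpha> x) = x) \<and>
      (\<forall>y\<in>carrier rat_dual. \<alpha> (\<beta> y) = y)"
proof -
  interpret R: dual_model rat_dual "rd_struct :: 'k ratfun \<Rightarrow> _" rd_S by (rule rat_dual_model)
  have QM: "dual_model (QT_alg p) \<iota> w" using QM.dual_model_axioms by (simp add: Q_TA)
  note \<alpha> = dual_models_unique_hom[OF QM rat_dual_model]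
  note \<beta> = dual_models_unique_hom[OF rat_dual_model QM]
  have QT_const: "QT_const p = (\<lambda>k. \<iota> (rat_const k))"
    by (simp add: \<iota>_def Q_struct_def)
  have rd_const: "rd_const = (\<lambda>k :: 'k. rd_struct (rat_const k))"
    by (simp add: rd_const_def fun_eq_iff)
  \<comment> \<open>Three prescribed values amount to two: once \<open>h\<close> sends
    \<open>\<iota> rat_T\<close> to T, cancellation turns the value at \<open>left rat_T\<close>
    into the condition that \<open>w\<close> goes to S, and the value at \<open>right rat_T\<close>
    follows.\<close>
  have gen: "h (left rat_T) = rd_T \<oplus>\<^bsub>rat_dual\<^esub> rd_S \<and>
          h (right rat_T) = rd_T \<ominus>\<^bsub>rat_dual\<^esub> rd_S \<and> h (\<iota> rat_T) = rd_T \<longleftrightarrow>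
        h (\<iota> rat_T) = rd_struct rat_T \<and> h w = rd_S"
    if "h \<in> ring_hom (QT_alg p) (rat_dual :: ('k ratfun, 'k poly set) tensor ring)" for h
  proof -
    interpret h: ring_hom_cring Q.TA "rat_dual :: ('k ratfun, 'k poly set) tensor ring" h
      by (intro ring_hom_cring.intro ring_hom_cring_axioms.intro Q.T.is_cring R.E.is_cring)
        (use that in \<open>simp add: Q_TA\<close>)
    have "h (left rat_T) = h (\<iota> rat_T) \<oplus>\<^bsub>rat_dual\<^esub> h w"
      "h (right rat_T) = h (\<iota> rat_T) \<ominus>\<^bsub>rat_dual\<^esub> h w"
      by (simp_all add: left_T right_T Q.T.minus_eq R.E.minus_eq)
    moreover have "h w \<in> carrier rat_dual" by simp
    ultimately show ?thesis
      using R.E.add.l_cancel[of "rd_struct rat_T" "h w" rd_S] R.s_closed R.i_simps(1)[of rat_T]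
      by (auto simp: rd_T_def)
  qed
  show ?thesis
  proof (intro exI conjI)
    show "{h \<in> alg_hom (const_field :: 'k ring) (QT_const p) (QT_alg p) rd_const rat_dual
             \<inter> extensional (carrier (QT_alg p)).
          h (QT_tensor p rat_T 1 1) = rd_T \<oplus>\<^bsub>rat_dual\<^esub> rd_S \<and>
          h (QT_tensor p 1 rat_T 1) = rd_T \<ominus>\<^bsub>rat_dual\<^esub> rd_S \<and>
          h (QT_tensor p 1 1 rat_T) = rd_T} =
      {\<lambda>x\<in>carrier (QT_alg p). R.of_dual (dual_model.to_dual (QT_alg p) \<iota> w x)}"
      unfolding \<alpha>(1)[symmetric] QT_const rd_const \<iota>_def[symmetric] left_def[symmetric] right_def[symmetric]
      by (rule Collect_cong, rule conj_cong[OF refl], rule gen) (simp add: alg_hom_def)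
    show "{h \<in> alg_hom (const_field :: 'k ring) rd_const rat_dual (QT_const p) (QT_alg p)
             \<inter> extensional (carrier rat_dual).
          h rd_T = QT_tensor p 1 1 rat_T \<and>
          h rd_S = QT_tensor p rat_T 1 1 \<ominus>\<^bsub>QT_alg p\<^esub> QT_tensor p 1 1 rat_T} =
      {\<lambda>x\<in>carrier rat_dual. dual_map.of_dual (QT_alg p) \<iota> w (R.to_dual x)}"
      unfolding QT_const rd_const rd_T_def \<iota>_def[symmetric] left_def[symmetric] w_def[symmetric]
      by (fact \<beta>(1))
  qed (use \<alpha>(2) \<beta>(2) in \<open>simp_all flip: Q_TA\<close>)
qed

end

section \<open>Quadratic forms\<close>

declare restrict_UNIV [simp]

abbreviation plane :: "('k::field ratfun, 'k ratfun \<times> 'k ratfun) module" where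
  "plane \<equiv> module_dsum ratfun_module ratfun_module"

text \<open>A binary quadratic form plus \<open>d\<close> times the Wronskian of \<open>G\<close>
  and \<open>F\<close>.\<close>

definition quad_form ::
  "'k::field ratfun \<Rightarrow> 'k ratfun \<Rightarrow> 'k ratfun \<Rightarrow> 'k ratfun \<Rightarrow> 'k ratfun \<times> 'k ratfun \<Rightarrow> 'k ratfun" where
  "quad_form a b c d = (\<lambda>(F, G). a * F\<^sup>2 + b * (F * G) + c * G\<^sup>2 +
     d * (rat_deriv F * G - F * rat_deriv G))"

text \<open>Four points that separate the coefficients. The Wronskian vanishes at the first three
  and is 1 at the last, because T has derivative 1.\<close>

lemma quad_form_basis:
  "quad_form a b c d (1, 0) = a" "quad_form a b c d (0, 1) = c"
  "quad_form a b c d (1, 1) = a + b + c"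
  "quad_form a b c d (rat_T, 1) = a * rat_T\<^sup>2 + b * rat_T + c + d"
  by (simp_all add: quad_form_def)

lemma quad_form_eq_iff:
  "quad_form a b c d = quad_form a' b' c' d' \<longleftrightarrow> a = a' \<and> b = b' \<and> c = c' \<and> d = d'"
proof
  assume eq: "quad_form a b c d = quad_form a' b' c' d'"
  have "a = a'" "c = c'"
    using eq quad_form_basis(1,2) by metis+
  moreover from this have "b = b'"
    using fun_cong[OF eq, of "(1, 1)"] by (simp add: quad_form_basis)
  ultimately show "a = a' \<and> b = b' \<and> c = c' \<and> d = d'"
    using fun_cong[OF eq, of "(rat_T, 1)"] by (simp add: quad_form_basis)
qed simp

lemma quad_form_linear:
  "quad_form (a + a') (b + b') (c + c') (d + d') x = quad_form a b c d x + quad_form a' b' c' d' x"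
  "quad_form (k * a) (k * b) (k * c) (k * d) x = k * quad_form a b c d x"
  by (simp_all add: quad_form_def algebra_simps split: prod.split)

lemma polar_quad_form:
  "polar plane ratfun_module (quad_form a b c d) = (\<lambda>(F, G) (F', G'). 2 * a * F * F' +
     b * (F * G' + F' * G) + 2 * c * G * G' +
     d * (rat_deriv F * G' + rat_deriv F' * G - F * rat_deriv G' - F' * rat_deriv G))"
  by (auto simp: fun_eq_iff polar_def quad_form_def rat_deriv_add power2_eq_square algebra_simps)

text \<open>The Wronskian scales by the square of every rational function, since the terms with the
  derivative of the scalar cancel. Its polar form is linear only over scalars of derivative zero,
  hence the alternative in the hypothesis.\<close>

lemma quad_form_in_quad_module:
  assumes "d = 0 \<or> (\<forall>r\<in>carrier R. rat_deriv r = 0)"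
  shows "quad_form a b c d \<in>
    carrier (quad_module R (\<lambda>x. x) ratfun_field plane ratfun_module)"
proof -
  have "quad_form a b c d (k * F, k * G) = k\<^sup>2 * quad_form a b c d (F, G)" for k F G
    by (simp add: quad_form_def rat_deriv_mult power2_eq_square algebra_simps)
  moreover have "polar plane ratfun_module (quad_form a b c d) \<in> bilinear_maps R
      (restrict_scalars (\<lambda>x. x) plane) (restrict_scalars (\<lambda>x. x) ratfun_module)"
    using assms unfolding polar_quad_form bilinear_maps_def mod_hom_def
    by (auto simp: rat_deriv_add rat_deriv_mult algebra_simps)
  ultimately show ?thesis
    by (auto simp: quad_module_def)
qed

section \<open>Bilinear forms over \<open>K(T\<^sup>p)\<close> that scale by squares\<close>

lemma plane_linearD:
  assumes "f \<in> mod_hom R (restrict_scalars (\<lambda>x. x) plane) (restrict_scalars (\<lambda>x. x) ratfun_module)"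
  shows "f (F + F', G + G') = f (F, G) + f (F', G')"
    and "r \<in> carrier R \<Longrightarrow> f (r * F, r * G) = r * f (F, G)"
  using assms by (simp_all add: mod_hom_def)

text \<open>A positive characteristic of a domain is prime, so the p-th power map is additive and
  turns a polynomial in T into one in T^p.\<close>

lemma (in frobenius_extension) to_fract_power_base: "to_fract q ^ p \<in> carrier base"
proof (induction q)
  case 0
  show ?case using p_pos rat_const_base[of 0] by (simp add: zero_power)
next
  case (pCons a q)
  have prime: "prime CHAR('k poly)"
    using char p_pos prime_CHAR_semidom[where ?'a = 'k] by simp
  have "(pCons a q) ^ p = ([:a:] + [:0, 1:] * q) ^ p" by simp
  also have "\<dots> = [:a:] ^ p + ([:0, 1:] * q) ^ p"
    by (rule freshmans_dream[OF prime]) (simp add: char)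
  finally have "to_fract (pCons a q ^ p) = to_fract ([:a:] ^ p + ([:0, 1:] * q) ^ p)"
    by (rule arg_cong)
  then have "to_fract (pCons a q) ^ p = rat_const (a ^ p) + rat_T ^ p * to_fract q ^ p"
    by (simp only: to_fract_add to_fract_mult to_fract_power rat_const_power power_mult_distrib
        flip: rat_const_def rat_T_def)
  then show ?case
    by (simp add: base_closed pCons.IH flip: rat_const_power)
qed

text \<open>Polarising \<open>b(tF, tG) = t\<^sup>2 b(F, G)\<close> at \<open>t = 1 + T\<close> gives a linear recurrence for the values
  \<open>b(T\<^sup>n, 1)\<close>. They determine \<open>b(F, 1)\<close> for polynomials \<open>F\<close>, and for fractions because
  \<open>F/G = F G\<^sup>p\<^sup>-\<^sup>1 / G\<^sup>p\<close>.\<close>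
lemma (in frobenius_extension) balanced_bilinear_eq_0:
  fixes b :: "'k ratfun \<Rightarrow> 'k ratfun \<Rightarrow> 'k ratfun"
  assumes add_left: "\<And>F F' G. b (F + F') G = b F G + b F' G"
    and add_right: "\<And>F G G'. b F (G + G') = b F G + b F G'"
    and smult: "\<And>r F G. r \<in> carrier base \<Longrightarrow> b (r * F) G = r * b F G"
    and square: "\<And>t F G. b (t * F) (t * G) = t\<^sup>2 * b F G"
    and basis: "b 1 1 = 0" "b rat_T 1 = 0"
  shows "b F G = 0"
proof -
  have flip: "b F (rat_T * G) + b (rat_T * F) G = 2 * rat_T * b F G" for F G
    using square[of "1 + rat_T" F G] square[of rat_T F G]
    by (simp add: distrib_right add_left add_right power2_eq_square algebra_simps)
  have recurrence: "b (rat_T * (rat_T * F)) G = 2 * rat_T * b (rat_T * F) G - rat_T\<^sup>2 * b F G" for F G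
    using flip[of "rat_T * F" G] square[of rat_T F G] by (simp add: algebra_simps)
  \<comment> \<open>The recurrence has order two, so two consecutive values are carried.\<close>
  have pow: "b (rat_T ^ n) 1 = 0 \<and> b (rat_T ^ Suc n) 1 = 0" for n
    by (induction n) (simp_all add: basis recurrence)
  have poly: "b (rat_T ^ n * to_fract q) 1 = 0" for n q
  proof (induction q arbitrary: n)
    case 0
    show ?case using smult[OF rat_const_base[of 0], of 1 1] by simp
  next
    case (pCons a q)
    have "rat_T ^ n * to_fract (pCons a q) = rat_const a * rat_T ^ n + rat_T ^ Suc n * to_fract q"
      by (simp add: to_fract_pCons algebra_simps)
    then show ?case
      by (simp only: add_left smult[OF rat_const_base] pow pCons.IH) simp
  qed
  have frac: "b F 1 = 0" for F
  proof -
    obtain n m where m: "m \<noteq> 0" and F: "F = Fract n m" by (cases F) auto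
    have "F = inverse (to_fract m ^ p) * to_fract (n * m ^ (p - 1))"
      using m p_pos
      by (simp add: F Fract_conv_to_fract to_fract_power field_simps flip: power_Suc)
    moreover have "inverse (to_fract m ^ p) \<in> carrier base"
      using m by (intro base_inverse to_fract_power_base) auto
    ultimately show ?thesis
      using smult poly[of 0 "n * m ^ (p - 1)"] by simp
  qed
  \<comment> \<open>For nonzero G the square law with t = G moves the second argument to 1; for G =
    0 additivity suffices.\<close>
  show ?thesis
  proof (cases "G = 0")
    case True
    then show ?thesis
      using add_right[of F 0 0] by (simp only: add_0_left add_cancel_right_right)
  next
    case False
    then show ?thesis using square[of G "F / G" 1] frac[of "F / G"] by simp
  qed
qed

text \<open>The product and the Wronskian satisfy the same hypotheses as \<open>b\<close>. The
  coefficients make the difference vanish at (1, 1) and (T, 1), where the Wronskian is 0 and 1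
  respectively.\<close>

lemma (in frobenius_extension) balanced_bilinear_eq:
  fixes b :: "'k ratfun \<Rightarrow> 'k ratfun \<Rightarrow> 'k ratfun"
  assumes add_left: "\<And>F F' G. b (F + F') G = b F G + b F' G"
    and add_right: "\<And>F G G'. b F (G + G') = b F G + b F G'"
    and smult: "\<And>r F G. r \<in> carrier base \<Longrightarrow> b (r * F) G = r * b F G"
    and square: "\<And>t F G. b (t * F) (t * G) = t\<^sup>2 * b F G"
  shows "b F G = b 1 1 * (F * G) + (b rat_T 1 - rat_T * b 1 1) * (rat_deriv F * G - F * rat_deriv G)"
proof -
  define \<beta> \<gamma> where "\<beta> = b 1 1" and "\<gamma> = b rat_T 1 - rat_T * b 1 1"
  have "b F G - \<beta> * (F * G) - \<gamma> * (rat_deriv F * G - F * rat_deriv G) = 0"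
    by (rule balanced_bilinear_eq_0
        [of "\<lambda>F G. b F G - \<beta> * (F * G) - \<gamma> * (rat_deriv F * G - F * rat_deriv G)"])
      (simp_all add: add_left add_right smult square rat_deriv_add rat_deriv_mult rat_deriv_base
        power2_eq_square algebra_simps, simp_all add: \<beta>_def \<gamma>_def)
  then show ?thesis by (simp add: \<beta>_def \<gamma>_def algebra_simps)
qed

text \<open>Homogeneity determines \<open>q\<close> on the two axes from its values at (1, 0) and
  (0, 1). The mixed part is the polar form between the axes; it inherits the square law from
  \<open>q\<close>, so \<open>balanced_bilinear_eq\<close> applies.\<close>

lemma (in frobenius_extension) quad_rel_carrier:
  "carrier (quad_rel p plane (ratfun_module :: ('k ratfun, _) module)) =
    {quad_form a b c d | a b c d. True}"
proof (intro equalityI subsetI)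
  fix q :: "'k ratfun \<times> 'k ratfun \<Rightarrow> 'k ratfun"
  assume "q \<in> carrier (quad_rel p plane ratfun_module)"
  then have square: "\<And>t F G. q (t * F, t * G) = t\<^sup>2 * q (F, G)"
    and pol: "polar plane ratfun_module q \<in> bilinear_maps base
      (restrict_scalars (\<lambda>x. x) plane) (restrict_scalars (\<lambda>x. x) ratfun_module)"
    by (auto simp: quad_module_def base_def)
  define b where "b F G = polar plane ratfun_module q (F, 0) (0, G)" for F G
  have b: "b F G = q (F, G) - q (F, 0) - q (0, G)" for F G
    by (simp add: b_def polar_def)
  have lin: "polar plane ratfun_module q x \<in> mod_hom base
        (restrict_scalars (\<lambda>x. x) plane) (restrict_scalars (\<lambda>x. x) ratfun_module)"
      "(\<lambda>y. polar plane ratfun_module q y x) \<in> mod_hom base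
        (restrict_scalars (\<lambda>x. x) plane) (restrict_scalars (\<lambda>x. x) ratfun_module)" for x
    using pol by (cases x, simp add: bilinear_maps_def)+
  have add_right: "b F (G + G') = b F G + b F G'" for F G G'
    using plane_linearD(1)[OF lin(1)[of "(F, 0)"], of 0 0 G G'] by (simp add: b_def)
  have add_left: "b (F + F') G = b F G + b F' G" for F F' G
    using plane_linearD(1)[OF lin(2)[of "(0, G)"], of F F' 0 0] by (simp add: b_def)
  have smult: "b (r * F) G = r * b F G" if "r \<in> carrier base" for r F G
    using plane_linearD(2)[OF lin(2)[of "(0, G)"] that, of F 0] by (simp add: b_def)
  have "b (t * F) (t * G) = t\<^sup>2 * b F G" for t F G
    using square[of t F G] square[of t F 0] square[of t 0 G] by (simp add: b algebra_simps)
  note b_eq = balanced_bilinear_eq[OF add_left add_right smult this]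
  have eq: "q (F, G) = quad_form (q (1, 0)) (b 1 1) (q (0, 1)) (b rat_T 1 - rat_T * b 1 1) (F, G)" for F G
    using b_eq[of F G] b[of F G] square[of F 1 0] square[of G 0 1]
    by (simp add: quad_form_def algebra_simps)
  have "q = quad_form (q (1, 0)) (b 1 1) (q (0, 1)) (b rat_T 1 - rat_T * b 1 1)"
  proof
    fix x
    show "q x = quad_form (q (1, 0)) (b 1 1) (q (0, 1)) (b rat_T 1 - rat_T * b 1 1) x"
      using eq[of "fst x" "snd x"] by (simp only: prod.collapse)
  qed
  then show "q \<in> {quad_form a b c d | a b c d. True}" by blast
next
  fix q :: "'k ratfun \<times> 'k ratfun \<Rightarrow> 'k ratfun"
  assume "q \<in> {quad_form a b c d | a b c d. True}"
  then show "q \<in> carrier (quad_rel p plane ratfun_module)"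
    using rat_deriv_base unfolding base_def by (auto intro!: quad_form_in_quad_module)
qed

lemma (in frobenius_extension) quad_abs_plane_carrier:
  "carrier (quad_abs plane (ratfun_module :: ('k ratfun, _) module)) = {quad_form a b c 0 | a b c. True}"
proof (intro equalityI subsetI)
  fix q :: "'k ratfun \<times> 'k ratfun \<Rightarrow> 'k ratfun"
  assume q: "q \<in> carrier (quad_abs plane ratfun_module)"
  then have "q \<in> carrier (quad_rel p plane ratfun_module)"
    by (auto simp: quad_module_def bilinear_maps_def mod_hom_def)
  then obtain a b c d where q_eq: "q = quad_form a b c d"
    unfolding quad_rel_carrier by blast
  from q have "(\<lambda>y. polar plane ratfun_module q y (0, 1)) \<in> mod_hom ratfun_field
        (restrict_scalars (\<lambda>x. x) plane) (restrict_scalars (\<lambda>x. x) ratfun_module)"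
    by (auto simp: quad_module_def bilinear_maps_def)
  \<comment> \<open>Linearity in the scalar T reads bT + d = Tb, which excludes the
    Wronskian.\<close>
  from plane_linearD(2)[OF this, of rat_T 1 0]
  have "polar plane ratfun_module q (rat_T, 0) (0, 1) =
      rat_T * polar plane ratfun_module q (1, 0) (0, 1)" by simp
  then have "d = 0" by (simp add: q_eq polar_quad_form)
  with q_eq show "q \<in> {quad_form a b c 0 | a b c. True}" by blast
next
  fix q :: "'k ratfun \<times> 'k ratfun \<Rightarrow> 'k ratfun"
  assume "q \<in> {quad_form a b c 0 | a b c. True}"
  then show "q \<in> carrier (quad_abs plane ratfun_module)"
    by (auto intro!: quad_form_in_quad_module)
qed

lemma square_in_quad_abs: "(\<lambda>F. a * F\<^sup>2) \<in> carrier (quad_abs ratfun_module ratfun_module)"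
  by (auto simp: quad_module_def bilinear_maps_def mod_hom_def polar_def power2_eq_square algebra_simps)

section \<open>Restriction to the summands and the isomorphisms of form modules\<close>

context frobenius_extension
begin

lemma restrict_summands_quad_form:
  "restrict_summands (quad_form a b c d) = (\<lambda>F. a * F\<^sup>2, \<lambda>G. c * G\<^sup>2)"
  by (simp add: restrict_summands_def quad_form_def)

lemma restrict_summands_hom:
  "restrict_summands \<in> mod_hom (ratfun_field :: 'k ratfun ring) (quad_rel p plane ratfun_module)
    (module_dsum (quad_abs ratfun_module ratfun_module) (quad_abs ratfun_module ratfun_module))"
proof -
  have "restrict_summands q \<in> carrier (module_dsum (quad_abs ratfun_module ratfun_module)
      (quad_abs ratfun_module ratfun_module))"
    if "q \<in> carrier (quad_rel p (plane :: ('k ratfun, _) module) ratfun_module)" for q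
    using that unfolding quad_rel_carrier
    by (auto simp: restrict_summands_quad_form square_in_quad_abs)
  then show ?thesis
    unfolding mod_hom_def
    by (auto simp: restrict_summands_def quad_module_def)
qed

abbreviation "quad_ker \<equiv> mod_ker
  (quad_rel p (plane :: ('k ratfun, 'k ratfun \<times> 'k ratfun) module) ratfun_module)
  (module_dsum (quad_abs ratfun_module ratfun_module) (quad_abs ratfun_module ratfun_module))
  restrict_summands"

lemma quad_ker_carrier: "carrier quad_ker = {quad_form 0 b 0 d | b d. True}"
proof -
  have iff: "quad_form a b c d \<in> carrier quad_ker \<longleftrightarrow> a = 0 \<and> c = 0" for a b c d :: "'k ratfun"
  proof -
    have "((\<lambda>F. a * F\<^sup>2) = (\<lambda>F. 0) \<and> (\<lambda>F. c * F\<^sup>2) = (\<lambda>F. 0)) \<longleftrightarrow> a = 0 \<and> c = 0"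
      by (auto simp: fun_eq_iff)
    moreover have "quad_form a b c d \<in> carrier (quad_rel p plane ratfun_module)"
      unfolding quad_rel_carrier by blast
    ultimately show ?thesis
      by (simp add: mod_ker_def restrict_summands_quad_form quad_module_def)
  qed
  show ?thesis
  proof (intro equalityI subsetI)
    fix q assume q: "q \<in> carrier quad_ker"
    then have "q \<in> carrier (quad_rel p plane ratfun_module)"
      by (simp add: mod_ker_def)
    then obtain a b c d where "q = quad_form a b c d"
      unfolding quad_rel_carrier by blast
    with q iff show "q \<in> {quad_form 0 b 0 d | b d. True}" by auto
  qed (use iff in auto)
qed

abbreviation "forms \<equiv> hom_module ratfun_field (\<lambda>a. a) rat_dual_module
  (ratfun_module :: ('k ratfun, 'k ratfun) module)"

abbreviation "const_forms \<equiv> hom_module const_field rat_const dual_module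
  (ratfun_module :: ('k ratfun, 'k ratfun) module)"

abbreviation "\<Phi> \<equiv> \<lambda>f (F, G). f (rat_subst (rd_T \<oplus>\<^bsub>rat_dual\<^esub> rd_S) F
  \<otimes>\<^bsub>rat_dual\<^esub> rat_subst (rd_T \<ominus>\<^bsub>rat_dual\<^esub> rd_S) (G :: 'k ratfun))"

text \<open>Multiplying F + F'S by G - G'S with S^2 = 0 leaves the Wronskian as the coefficient of
  S.\<close>

lemma substitution:
  "rat_subst (rd_T \<oplus>\<^bsub>rat_dual\<^esub> rd_S) F \<otimes>\<^bsub>rat_dual\<^esub> rat_subst (rd_T \<ominus>\<^bsub>rat_dual\<^esub> rd_S) G =
    dual_map.of_dual rat_dual rd_struct rd_S
      (Dual (F * G) (rat_deriv F * G - F * rat_deriv (G :: 'k ratfun)))"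
proof -
  interpret R: dual_model rat_dual "rd_struct :: 'k ratfun \<Rightarrow> _" rd_S by (rule rat_dual_model)
  have "rd_struct (- 1 :: 'k ratfun) = \<ominus>\<^bsub>rat_dual\<^esub> \<one>\<^bsub>rat_dual\<^esub>"
    using R.i_simps(4)[of "- 1" 1] R.i_simps(2,3) by (simp add: R.E.minus_equality)
  then have eqs: "rd_T \<oplus>\<^bsub>rat_dual\<^esub> rd_S = R.of_dual (Dual rat_T 1)"
    "rd_T \<ominus>\<^bsub>rat_dual\<^esub> rd_S = R.of_dual (Dual rat_T (- 1))"
    by (simp_all add: rd_T_def R.of_dual_def R.E.l_minus R.E.minus_eq)
  show ?thesis
    unfolding eqs rat_subst_eq
    using ring_hom_mult[OF R.of_dual_hom, of "taylor 1 F" "taylor (- 1) G"]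
    by (simp add: taylor_def times_dual_def algebra_simps)
qed

lemma id_hom: "(\<lambda>a. a) \<in> ring_hom (ratfun_field :: 'k ratfun ring) ratfun_field"
  by (rule ring_hom_memI) auto

lemma form_values:
  assumes "f \<in> carrier forms"
  shows "f (rat_subst (rd_T \<oplus>\<^bsub>rat_dual\<^esub> rd_S) F \<otimes>\<^bsub>rat_dual\<^esub> rat_subst (rd_T \<ominus>\<^bsub>rat_dual\<^esub> rd_S) G) =
    F * G * f \<one>\<^bsub>rat_dual\<^esub> + (rat_deriv F * G - F * rat_deriv G) * f rd_S"
proof -
  interpret R: dual_model rat_dual "rd_struct :: 'k ratfun \<Rightarrow> _" rd_S by (rule rat_dual_model)
  show ?thesis
    unfolding substitution using R.linear_form_eq[OF id_hom assms] by simp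
qed

text \<open>Both sides have the same coordinates: a linear form is its pair of values at 1 and S,
  and a form in the kernel is the pair (b, d).\<close>

lemma forms_iso: "\<Phi> \<in> mod_iso (ratfun_field :: 'k ratfun ring) forms quad_ker"
proof -
  interpret R: dual_model rat_dual "rd_struct :: 'k ratfun \<Rightarrow> _" rd_S by (rule rat_dual_model)
  have \<Phi>: "\<Phi> f = quad_form 0 (f \<one>\<^bsub>rat_dual\<^esub>) 0 (f rd_S)" if "f \<in> carrier forms" for f
    using form_values[OF that] by (auto simp: fun_eq_iff quad_form_def algebra_simps)
  let ?V = "\<lambda>f. (f \<one>\<^bsub>rat_dual\<^esub>, f rd_S)" and ?N = "\<lambda>(b, d). quad_form 0 b 0 d :: 'k ratfun \<times> 'k ratfun \<Rightarrow> _"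
  have V: "bij_betw ?V (carrier forms) UNIV"
    using R.linear_forms_iso[OF id_hom] by (simp add: mod_iso_def)
  have "bij_betw ?N UNIV (carrier quad_ker)"
    by (auto simp: bij_betw_def inj_on_def quad_form_eq_iff quad_ker_carrier)
  from bij_betw_trans[OF V this] have bij: "bij_betw \<Phi> (carrier forms) (carrier quad_ker)"
    by (rule bij_betw_cong[THEN iffD1, rotated]) (simp add: \<Phi>)
  have closed: "rat_subst (rd_T \<oplus>\<^bsub>rat_dual\<^esub> rd_S) F \<otimes>\<^bsub>rat_dual\<^esub>
      rat_subst (rd_T \<ominus>\<^bsub>rat_dual\<^esub> rd_S) G \<in> carrier rat_dual" for F G :: "'k ratfun"
    unfolding substitution by simp
  have "\<Phi> \<in> carrier forms \<rightarrow> carrier quad_ker"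
    using bij by (rule bij_betw_imp_funcset)
  then have "\<Phi> \<in> mod_hom (ratfun_field :: 'k ratfun ring) forms quad_ker"
    unfolding mod_hom_def
    by (auto simp: hom_module_def mod_ker_def quad_module_def pointwise_module_def
        alg_module_def closed fun_eq_iff ring_of_type_algebra_def)
  with bij show ?thesis by (simp add: mod_iso_def)
qed

lemma const_forms_iso:
  "(\<lambda>g. (g \<one>\<^bsub>dual_alg\<^esub>, g dual_S)) \<in> mod_iso (ratfun_field :: 'k ratfun ring) const_forms plane"
  by (rule dual_model.linear_forms_iso[OF dual_alg_model rat_const_hom])

text \<open>Bijectivity is two out of three: evaluation at 1 and S is bijective on
  \<open>const_forms\<close>, and composed with the restriction it becomes the bijective evaluation
  on \<open>forms\<close>.\<close>

lemma restrict_form_iso: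
  "(\<lambda>f. \<lambda>l\<in>carrier dual_alg. f (rd_tensor 1 l)) \<in>
    mod_iso (ratfun_field :: 'k ratfun ring) forms const_forms"
proof -
  interpret R: dual_model rat_dual "rd_struct :: 'k ratfun \<Rightarrow> _" rd_S by (rule rat_dual_model)
  interpret D: dual_model dual_alg "dual_const :: 'k \<Rightarrow> _" dual_S by (rule dual_alg_model)
  let ?\<Psi> = "\<lambda>f. \<lambda>l\<in>carrier dual_alg. f (rd_tensor (1 :: 'k ratfun) l)"
  have closed: "rd_tensor (1 :: 'k ratfun) l \<in> carrier rat_dual" if "l \<in> carrier dual_alg" for l
    using rd_tensor_1_eq[of l "D.to_dual l"] that by simp
  have "?\<Psi> f (D.of_dual d) = rat_const (re d) * f \<one>\<^bsub>rat_dual\<^esub> + rat_const (eps d) * f rd_S"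
    if "f \<in> carrier forms" for f d
    using R.linear_form_eq[OF id_hom that] rd_tensor_1_eq[OF refl, of d] by simp
  then have \<Psi>: "?\<Psi> f \<in> carrier const_forms" if "f \<in> carrier forms" for f
    using that unfolding D.linear_form_iff[OF rat_const_hom] by auto
  have rd: "rd_tensor (1 :: 'k ratfun) \<one>\<^bsub>dual_alg\<^esub> = \<one>\<^bsub>rat_dual\<^esub>" "rd_tensor 1 dual_S = (rd_S :: ('k ratfun, _) tensor)"
    using R.i_simps(3) by (simp_all add: rd_struct_def rd_S_def)
  let ?V = "\<lambda>g. (g \<one>\<^bsub>dual_alg\<^esub>, g dual_S)"
  have V: "bij_betw ?V (carrier const_forms) UNIV"
    using const_forms_iso by (simp add: mod_iso_def)
  have "bij_betw (?V \<circ> ?\<Psi>) (carrier forms) UNIV"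
    using R.linear_forms_iso[OF id_hom] by (simp add: mod_iso_def comp_def rd)
  then have "bij_betw ?\<Psi> (carrier forms) (carrier const_forms)"
    using bij_betw_comp_iff2[OF V, of ?\<Psi> "carrier forms"] \<Psi> by blast
  moreover have "?\<Psi> \<in> mod_hom (ratfun_field :: 'k ratfun ring) forms const_forms"
    unfolding mod_hom_def using \<Psi> closed
    by (auto simp: hom_module_def fun_eq_iff restrict_def)
  ultimately show ?thesis by (simp add: mod_iso_def)
qed

text \<open>The splitting is expressed through the values of \<open>q\<close> at the points of
  \<open>quad_form_basis\<close>, so its linearity is a pointwise computation. Its second component
  recovers the Wronskian coefficient.\<close>

lemma quad_rel_iso:
  "mod_iso (ratfun_field :: 'k ratfun ring) (quad_rel p plane ratfun_module)
    (module_dsum (quad_abs plane ratfun_module) ratfun_module) \<noteq> {}"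
proof -
  define B :: "('k ratfun \<times> 'k ratfun \<Rightarrow> 'k ratfun) \<Rightarrow> 'k ratfun" where
    "B q = q (1, 1) - q (1, 0) - q (0, 1)" for q
  define h :: "('k ratfun \<times> 'k ratfun \<Rightarrow> 'k ratfun) \<Rightarrow> _" where
    "h q = (quad_form (q (1, 0)) (B q) (q (0, 1)) 0,
       q (rat_T, 1) - (q (1, 0) * rat_T\<^sup>2 + B q * rat_T + q (0, 1)))" for q
  have h: "h (quad_form a b c d) = (quad_form a b c 0, d)" for a b c d
    by (simp add: h_def B_def quad_form_basis)
  have bij: "bij_betw h (carrier (quad_rel p plane ratfun_module))
      (carrier (module_dsum (quad_abs plane ratfun_module) ratfun_module))"
    unfolding bij_betw_def inj_on_def quad_rel_carrier
    by (auto simp: h quad_form_eq_iff quad_abs_plane_carrier image_iff)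
      (use h in \<open>metis+\<close>)
  have "h (\<lambda>x. q x + q' x) = (\<lambda>x. fst (h q) x + fst (h q') x, snd (h q) + snd (h q'))" for q q'
    using quad_form_linear(1)[of "q (1, 0)" "q' (1, 0)" "B q" "B q'" "q (0, 1)" "q' (0, 1)" 0 0]
    by (simp add: h_def B_def fun_eq_iff algebra_simps)
  moreover have "h (\<lambda>x. k * q x) = (\<lambda>x. k * fst (h q) x, k * snd (h q))" for k q
    using quad_form_linear(2)[of k "q (1, 0)" "B q" "q (0, 1)" 0]
    by (simp add: h_def B_def fun_eq_iff algebra_simps)
  ultimately have "h \<in> mod_iso (ratfun_field :: 'k ratfun ring) (quad_rel p plane ratfun_module)
    (module_dsum (quad_abs plane ratfun_module) ratfun_module)"
    using bij bij_betw_imp_funcset[OF bij] unfolding mod_iso_def mod_hom_def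
    by (simp add: quad_module_def)
  then show ?thesis by blast
qed

end

theorem proposition4p2:
  fixes p :: nat
  assumes "CHAR('k::field) = p" and "p > 0"
  shows
    "(\<exists>\<alpha> \<beta>.
        {h \<in> alg_hom (const_field :: 'k ring) (QT_const p) (QT_alg p) rd_const rat_dual
               \<inter> extensional (carrier (QT_alg p)).
            h (QT_tensor p rat_T 1 1) = rd_T \<oplus>\<^bsub>rat_dual\<^esub> rd_S \<and>
            h (QT_tensor p 1 rat_T 1) = rd_T \<ominus>\<^bsub>rat_dual\<^esub> rd_S \<and>
            h (QT_tensor p 1 1 rat_T) = rd_T} = {\<alpha>} \<and>
        {h \<in> alg_hom (const_field :: 'k ring) rd_const rat_dual (QT_const p) (QT_alg p)
               \<inter> extensional (carrier rat_dual).
            h rd_T = QT_tensor p 1 1 rat_T \<and>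
            h rd_S = QT_tensor p rat_T 1 1 \<ominus>\<^bsub>QT_alg p\<^esub> QT_tensor p 1 1 rat_T} = {\<beta>} \<and>
        \<alpha> \<in> ring_iso (QT_alg p) rat_dual \<and>
        \<beta> \<in> ring_iso rat_dual (QT_alg p) \<and>
        (\<forall>x\<in>carrier (QT_alg p). \<beta> (\<alpha> x) = x) \<and>
        (\<forall>y\<in>carrier rat_dual. \<alpha> (\<beta> y) = y))
     \<and> mod_iso (ratfun_field :: 'k ratfun ring) (WT_module p) ratfun_module \<noteq> {}
     \<and> restrict_summands \<in> mod_hom (ratfun_field :: 'k ratfun ring)
         (quad_rel p (module_dsum ratfun_module ratfun_module) ratfun_module)
         (module_dsum (quad_abs ratfun_module ratfun_module) (quad_abs ratfun_module ratfun_module))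
     \<and> (\<lambda>f (F, G). f (rat_subst (rd_T \<oplus>\<^bsub>rat_dual\<^esub> rd_S) F
                       \<otimes>\<^bsub>rat_dual\<^esub> rat_subst (rd_T \<ominus>\<^bsub>rat_dual\<^esub> rd_S) G))
         \<in> mod_iso (ratfun_field :: 'k ratfun ring)
             (hom_module ratfun_field (\<lambda>a. a) rat_dual_module ratfun_module)
             (mod_ker
               (quad_rel p (module_dsum ratfun_module ratfun_module) ratfun_module)
               (module_dsum (quad_abs ratfun_module ratfun_module) (quad_abs ratfun_module ratfun_module))
               restrict_summands)
     \<and> (\<forall>f \<in> carrier (hom_module ratfun_field (\<lambda>a. a) rat_dual_module
                          (ratfun_module :: ('k ratfun, 'k ratfun) module)).
          \<forall>F G. f (rat_subst (rd_T \<oplus>\<^bsub>rat_dual\<^esub> rd_S) F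
                    \<otimes>\<^bsub>rat_dual\<^esub> rat_subst (rd_T \<ominus>\<^bsub>rat_dual\<^esub> rd_S) G)
              = F * G * f \<one>\<^bsub>rat_dual\<^esub> + (rat_deriv F * G - F * rat_deriv G) * f rd_S)
     \<and> (\<lambda>f. \<lambda>l\<in>carrier dual_alg. f (rd_tensor 1 l))
         \<in> mod_iso (ratfun_field :: 'k ratfun ring)
             (hom_module ratfun_field (\<lambda>a. a) rat_dual_module ratfun_module)
             (hom_module const_field rat_const dual_module ratfun_module)
     \<and> (\<lambda>g. (g \<one>\<^bsub>dual_alg\<^esub>, g dual_S))
         \<in> mod_iso (ratfun_field :: 'k ratfun ring)
             (hom_module const_field rat_const dual_module ratfun_module)
             (module_dsum ratfun_module ratfun_module)
     \<and> mod_iso (ratfun_field :: 'k ratfun ring)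
         (quad_rel p (module_dsum ratfun_module ratfun_module) ratfun_module)
         (module_dsum (quad_abs (module_dsum ratfun_module ratfun_module) ratfun_module) ratfun_module) \<noteq> {}"
proof -
  interpret frobenius_extension p "frob_subfield p :: 'k ratfun ring"
    by unfold_locales (use assms in simp_all)
  show ?thesis
    by (intro conjI ballI allI isomorphisms WT_iso restrict_summands_hom forms_iso form_values
        restrict_form_iso const_forms_iso quad_rel_iso)
qed

end
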